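(* Let $d,j\in\mathbb{N}$ with $d>j$. There exists a polynomial $T^j_d(z)\in\mathbb{C}[z]$ of degree $d$ with $\left\lceil\frac12\left\lfloor\frac{d-1}{j}\right\rfloor\right\rceil$ critical points of multiplicity $j$ with critical value $-1$ and $\left\lfloor\frac12\left\lfloor\frac{d-1}{j}\right\rfloor\right\rfloor$ critical points of multiplicity $j$ with critical value $+1$.
   Context: A point $z_0\in\mathbb{C}$ is a critical point of multiplicity $j$ of a polynomial $g\in\mathbb{C}[z]$ if $g^{(1)}(z_0)=\dots=g^{(j)}(z_0)=0$; the number $g(z_0)$ is its critical value. *)

theory Defs
  imports Complex_Main "HOL-Computational_Algebra.Polynomial"
begin

definition crit_point_mult :: "complex poly \<Rightarrow> nat \<Rightarrow> complex \<Rightarrow> bool" where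
  "crit_point_mult g j z0 \<longleftrightarrow> (\<forall>i\<in>{1..j}. poly ((pderiv ^^ i) g) z0 = 0)"

end

theory Submission
  imports Defs "HOL-Complex_Analysis.Complex_Analysis"
    "HOL-Computational_Algebra.Fundamental_Theorem_Algebra"
begin

text \<open>
  Put \<open>n = (d - 1) div j\<close> and consider the polynomials \<open>T\<close> of degree \<open>d\<close> with \<open>n\<close> critical points, one of
  them absorbing the remaining \<open>(d - 1) mod j\<close> zeros of the derivative. Their critical values are
  functions of the critical points and the constant term, proper once their centroid is fixed, and with
  surjective derivative wherever the critical points are distinct. Start from a polynomial with
  real critical points \<open>x\<^sub>0 < x\<^sub>1 < \<dots>\<close>, choose two disjoint topological discs that contain the critical
  values of even and of odd index, respectively, and minimise the distance of the critical values to the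
  centres of their discs. The minimum is zero unless critical points collide. Collisions are
  excluded by the side condition that critical points of equal parity lie in different components of the
  preimage of their disc. This condition is both open and closed as long as no critical value crosses
  the boundary of a disc. It holds initially, because for every real critical point the preimage of
  a vertical ray contains curves from that point to infinity in both half-planes, and these separate
  its two neighbours.
\<close>

section \<open>Components of sublevel sets\<close>

text \<open>For \<open>j = 1\<close> Chebyshev polynomials are a solution; the general case is
  reached by deformation. The obstacle is that critical points of equal parity share a target value,
  so their values alone do not stop them from merging into one point of higher multiplicity; this is
  why the side condition is about components and not about values. Points of opposite parity cannot
  merge because their values lie in disjoint discs. The centroid is fixed because a translation
  moves all critical points without changing any value. The discs are only topological because the
  initial values of both parities may interlace on the real line: a shear
  \<open>w + \<i> * f (Re w)\<close> moves them into the half-plane of their parity, where two large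
  round discs touching at 0 contain them. If the minimal distance were positive, surjectivity of the
  derivative would give a motion under which every sheared value heads straight for its centre. Once
  all values sit at the two centres, an affine map sends these to -1 and 1. Further critical points
  of multiplicity \<open>j\<close> cannot occur, since each uses up \<open>j\<close> of the
  \<open>d - 1\<close> zeros of the derivative.\<close>

lemma connected_component_interior_of_frontier:
  fixes U K :: "'a::real_normed_vector set"
  assumes U: "open U" "U \<subseteq> K"
    and loc: "\<And>p. p \<in> K - U \<Longrightarrow> \<exists>N. open N \<and> p \<in> N \<and> connected (N \<inter> U)"
    and cl: "K \<subseteq> closure U"
    and ab: "connected_component K a b" "a \<in> U" "b \<in> U"
  shows "connected_component U a b"
proof (rule ccontr)
  assume nc: "\<not> connected_component U a b"
  define V where "V = connected_component_set U a"
  define W where "W = \<Union>(connected_component_set U ` (U - V))"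
  have oV: "open V" and oW: "open W"
    unfolding V_def W_def using U open_connected_component by blast+
  have aV: "a \<in> V" and bV: "b \<notin> V"
    using ab nc by (auto simp: V_def)
  have disj: "V \<inter> W = {}"
  proof -
    have False if xV: "x \<in> V" and xW: "x \<in> W" for x
    proof -
      obtain y where y: "y \<in> U" "y \<notin> V" "connected_component U y x"
        using xW unfolding W_def by blast
      have "connected_component U a x" using xV by (simp add: V_def)
      then have "connected_component U a y"
        using y(3) connected_component_sym connected_component_trans by metis
      then show False using y by (simp add: V_def)
    qed
    then show ?thesis by blast
  qed
  have VU: "V \<subseteq> U" and WU: "W \<subseteq> U"
    unfolding V_def W_def using connected_component_subset by blast+
  have cover: "U = V \<union> W"
    using VU WU by (auto simp: W_def)
  \<comment> \<open>A common point of both closures lies on the frontier of \<open>U\<close>; its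
    neighbourhood \<open>N\<close> meets \<open>V\<close> and \<open>W\<close>, which would
    disconnect \<open>N \<inter> U\<close>. The two closures therefore split \<open>K\<close> with
    \<open>a\<close> and \<open>b\<close> on different sides.\<close>
  have closure_disj: "closure V \<inter> closure W \<inter> K = {}"
  proof (rule ccontr)
    assume "closure V \<inter> closure W \<inter> K \<noteq> {}"
    then obtain p where p: "p \<in> closure V" "p \<in> closure W" "p \<in> K" by blast
    have "p \<notin> U"
      using p cover disj open_Int_closure_eq_empty[OF oV, of W] open_Int_closure_eq_empty[OF oW, of V] by blast
    then obtain N where N: "open N" "p \<in> N" "connected (N \<inter> U)" using loc p by blast
    have "N \<inter> V \<noteq> {}" "N \<inter> W \<noteq> {}"
      using p N open_Int_closure_eq_empty[of N V] open_Int_closure_eq_empty[of N W] by blast+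
    then show False
      using connectedD[OF N(3) oV oW] disj cover by blast
  qed
  have Kcover: "K \<subseteq> closure V \<union> closure W"
  proof
    fix p assume "p \<in> K"
    then show "p \<in> closure V \<union> closure W"
      using cl cover by auto
  qed
  let ?C = "connected_component_set K a"
  have "connected ?C" "a \<in> ?C" "b \<in> ?C" "?C \<subseteq> K"
    using ab U connected_component_subset by auto
  moreover have "b \<in> W" using cover ab bV by blast
  moreover have "?C \<subseteq> closure V \<union> closure W" "closure V \<inter> closure W \<inter> ?C = {}"
    using Kcover closure_disj \<open>?C \<subseteq> K\<close> by blast+
  moreover have "a \<in> closure V" "b \<in> closure W"
    using aV \<open>b \<in> W\<close> closure_subset by blast+
  ultimately show False
    unfolding connected_closed using closed_closure by blast
qed

text \<open>Near a boundary point that is not critical, the sublevel set is the homeomorphic image of the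
  intersection of two discs, so no two components of the open set can touch there.\<close>

lemma connected_component_sublevel_closed:
  fixes T :: "complex \<Rightarrow> complex"
  assumes hol: "T holomorphic_on UNIV"
    and h: "continuous_on UNIV h" "continuous_on UNIV k" "\<And>w. h (k w) = w" "\<And>w. k (h w) = (w::complex)"
    and M: "M > 0"
    and crit: "\<And>p. norm (h (T p) - a) = M \<Longrightarrow> deriv T p \<noteq> 0"
    and ab: "connected_component {x. norm (h (T x) - a) \<le> M} x y"
      "norm (h (T x) - a) < M" "norm (h (T y) - a) < M"
  shows "connected_component {x. norm (h (T x) - a) < M} x y"
proof -
  define U where "U = {x. norm (h (T x) - a) < M}"
  have cT: "continuous_on UNIV T" using hol holomorphic_on_imp_continuous_on by blast
  have chT: "continuous_on UNIV (\<lambda>x. h (T x))"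
    using continuous_on_compose2[OF h(1) cT] by auto
  have oU: "open U" unfolding U_def
    by (intro open_Collect_less continuous_intros chT)
  \<comment> \<open>Used twice: with \<open>B = UNIV\<close> for local connectedness of
    \<open>U\<close> at its frontier, and with arbitrary \<open>B\<close> to see that every point of
    the level curve is a limit of points of \<open>U\<close>.\<close>
  have loc: "\<exists>N. open N \<and> p \<in> N \<and> connected (N \<inter> U) \<and> N \<inter> U \<inter> B \<noteq> {}"
    if p: "norm (h (T p) - a) = M" and B: "open B" "p \<in> B" for p B
  proof -
    obtain r where r: "r > 0" "ball p r \<subseteq> B" "open (T ` ball p r)" "inj_on T (ball p r)"
      using has_complex_derivative_locally_invertible[OF holomorphic_on_subset[OF hol subset_UNIV] B(2,1) crit[OF p]] by metis
    have holb: "T holomorphic_on ball p r" using hol holomorphic_on_subset by blast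
    obtain g where g: "g holomorphic_on (T ` ball p r)" "\<And>z. z \<in> ball p r \<Longrightarrow> g (T z) = z"
      using holomorphic_has_inverse[OF holb open_ball r(4)] by metis
    define W where "W = h ` T ` ball p r"
    have Weq: "W = k -` (T ` ball p r)"
    proof (intro set_eqI iffI)
      fix w assume "w \<in> W" then show "w \<in> k -` (T ` ball p r)" unfolding W_def using h(4) by auto
    next
      fix w assume "w \<in> k -` (T ` ball p r)"
      then have "h (k w) \<in> W" unfolding W_def by blast
      then show "w \<in> W" using h(3) by simp
    qed
    have "open W" unfolding Weq by (intro open_vimage r h)
    moreover have "h (T p) \<in> W" unfolding W_def using r by auto
    ultimately obtain e where e: "e > 0" "ball (h (T p)) e \<subseteq> W"
      using open_contains_ball by blast
    define N where "N = ball p r \<inter> (\<lambda>x. h (T x)) -` ball (h (T p)) e"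
    have N1: "open N" unfolding N_def by (intro open_Int open_ball open_vimage chT)
    have N2: "p \<in> N" unfolding N_def using r e by auto
    have Neq: "N \<inter> U = (\<lambda>w. g (k w)) ` (ball (h (T p)) e \<inter> ball a M)" (is "?L = ?R")
    proof
      show "?L \<subseteq> ?R"
      proof
        fix x assume x: "x \<in> ?L"
        then have "x = g (k (h (T x)))" using g h by (auto simp: N_def)
        moreover have "h (T x) \<in> ball (h (T p)) e \<inter> ball a M"
          using x by (auto simp: N_def U_def dist_norm norm_minus_commute)
        ultimately show "x \<in> ?R" by blast
      qed
      show "?R \<subseteq> ?L"
      proof
        fix x assume "x \<in> ?R"
        then obtain w where w: "w \<in> ball (h (T p)) e" "w \<in> ball a M" "x = g (k w)" by blast
        then obtain z where z: "z \<in> ball p r" "w = h (T z)" using e by (auto simp: W_def)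
        then have "x = z" using w g h by simp
        then show "x \<in> ?L" using w z by (auto simp: N_def U_def dist_norm norm_minus_commute)
      qed
    qed
    have "connected (ball (h (T p)) e \<inter> ball a M)"
      by (intro convex_connected convex_Int convex_ball)
    moreover have "continuous_on (ball (h (T p)) e \<inter> ball a M) (\<lambda>w. g (k w))"
    proof (rule continuous_on_compose2[OF holomorphic_on_imp_continuous_on[OF g(1)]])
      show "continuous_on (ball (h (T p)) e \<inter> ball a M) k" using h(2) continuous_on_subset by blast
      show "k ` (ball (h (T p)) e \<inter> ball a M) \<subseteq> T ` ball p r"
        using e Weq by auto
    qed
    ultimately have N3: "connected (N \<inter> U)" unfolding Neq using connected_continuous_image by blast
    have "h (T p) \<in> closure (ball a M)" using p M by (simp add: dist_norm norm_minus_commute)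
    then have "ball (h (T p)) e \<inter> ball a M \<noteq> {}"
      using open_Int_closure_eq_empty[of "ball (h (T p)) e" "ball a M"] centre_in_ball[of "h (T p)" e] e(1)
      by blast
    then have "N \<inter> U \<noteq> {}" unfolding Neq by blast
    moreover have "N \<subseteq> B" using r by (auto simp: N_def)
    ultimately show ?thesis using N1 N2 N3 by blast
  qed
  have "connected_component U x y"
  proof (rule connected_component_interior_of_frontier[OF oU])
    show "U \<subseteq> {x. norm (h (T x) - a) \<le> M}" by (auto simp: U_def)
    show "\<exists>N. open N \<and> p \<in> N \<and> connected (N \<inter> U)" if "p \<in> {x. norm (h (T x) - a) \<le> M} - U" for p
      using loc[of p UNIV] that by (auto simp: U_def)
    show "{x. norm (h (T x) - a) \<le> M} \<subseteq> closure U"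
    proof
      fix p assume p: "p \<in> {x. norm (h (T x) - a) \<le> M}"
      show "p \<in> closure U"
      proof (cases "norm (h (T p) - a) = M")
        case True
        have "B \<inter> U \<noteq> {}" if "open B" "p \<in> B" for B
          using loc[OF True that] by blast
        then show ?thesis unfolding closure_iff_nhds_not_empty by blast
      next
        case False
        then show ?thesis using p closure_subset[of U] by (auto simp: U_def)
      qed
    qed
  qed (use ab in \<open>auto simp: U_def\<close>)
  then show ?thesis by (simp add: U_def)
qed

text \<open>Violations at arbitrarily late indices would accumulate in \<open>C\<close> at a point
  violating the bound for \<open>u\<close> itself.\<close>

lemma eventually_less_on_compact:
  fixes F :: "'u::metric_space \<Rightarrow> 'a::metric_space \<Rightarrow> real"
  assumes F: "continuous_on UNIV (\<lambda>(u, x). F u x)" and C: "compact C"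
    and less: "\<And>x. x \<in> C \<Longrightarrow> F u x < M" and u: "us \<longlonglongrightarrow> u"
  shows "eventually (\<lambda>m. \<forall>x\<in>C. F (us m) x < M) sequentially"
proof (rule ccontr)
  assume "\<not> ?thesis"
  then have "\<exists>m\<ge>N. \<exists>x\<in>C. F (us m) x \<ge> M" for N
    by (auto simp: eventually_sequentially not_less)
  then obtain m x where m: "\<And>N. m N \<ge> N" "\<And>N. x N \<in> C" "\<And>N. F (us (m N)) (x N) \<ge> M"
    by metis
  obtain y r where y: "y \<in> C" "strict_mono r" "(x \<circ> r) \<longlonglongrightarrow> y"
    using C m(2) unfolding compact_def by blast
  have "filterlim m at_top sequentially"
    using m(1) by (intro filterlim_at_top_mono[OF filterlim_ident]) auto
  then have "(\<lambda>N. us (m (r N))) \<longlonglongrightarrow> u"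
    using filterlim_compose[OF u filterlim_compose[OF _ filterlim_subseq[OF y(2)]]] by blast
  then have "(\<lambda>N. (us (m (r N)), x (r N))) \<longlonglongrightarrow> (u, y)"
    using y(3) by (intro tendsto_Pair) (auto simp: o_def)
  then have "(\<lambda>N. F (us (m (r N))) (x (r N))) \<longlonglongrightarrow> F u y"
    using continuous_on_tendsto_compose[OF F] by fastforce
  then have "F u y \<ge> M"
    by (rule LIMSEQ_le_const) (use m in auto)
  then show False using less[OF y(1)] by simp
qed

text \<open>A path from \<open>p\<close> to \<open>q\<close> together with closed balls around its
  ends is compact and connected, so nearby functions stay below \<open>M\<close> on all of it. The
  balls are there to catch the moving endpoints.\<close>

lemma connected_component_sublevel_persists:
  fixes F :: "'u::metric_space \<Rightarrow> complex \<Rightarrow> real"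
  assumes F: "continuous_on UNIV (\<lambda>(u, x). F u x)"
    and lim: "us \<longlonglongrightarrow> u" "ps \<longlonglongrightarrow> p" "qs \<longlonglongrightarrow> q"
    and cc: "connected_component {x. F u x < M} p q"
  shows "eventually (\<lambda>m. connected_component {x. F (us m) x < M} (ps m) (qs m)) sequentially"
proof -
  let ?U = "{x. F u x < M}"
  have cFu: "continuous_on UNIV (F u)"
  proof -
    have "continuous_on UNIV (\<lambda>x. (\<lambda>(u, x). F u x) (u, x))"
      by (intro continuous_on_compose2[OF F] continuous_intros) auto
    then show ?thesis by simp
  qed
  have oU: "open ?U" by (intro open_Collect_less continuous_intros cFu)
  then have "path_component ?U p q" using cc by (simp add: open_path_connected_component)
  then obtain g where g: "path g" "path_image g \<subseteq> ?U" "pathstart g = p" "pathfinish g = q"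
    unfolding path_component_def by blast
  have pq: "p \<in> ?U" "q \<in> ?U" using g pathstart_in_path_image pathfinish_in_path_image by blast+
  obtain r where r: "r > 0" "cball p r \<subseteq> ?U" using oU pq open_contains_cball by blast
  obtain r' where r': "r' > 0" "cball q r' \<subseteq> ?U" using oU pq open_contains_cball by blast
  define C where "C = path_image g \<union> cball p r \<union> cball q r'"
  have "compact C" unfolding C_def using g by (intro compact_Un compact_path_image compact_cball)
  moreover have "x \<in> C \<Longrightarrow> F u x < M" for x using g r r' unfolding C_def by blast
  ultimately have ev: "eventually (\<lambda>m. \<forall>x\<in>C. F (us m) x < M) sequentially"
    using eventually_less_on_compact[OF F _ _ lim(1)] by blast
  have "p \<in> path_image g" "q \<in> path_image g" 
    using g pathstart_in_path_image pathfinish_in_path_image by blast+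
  then have conn: "connected C" unfolding C_def
    using r(1) r'(1) connected_path_image[OF g(1)] by (intro connected_Un connected_cball) fastforce+
  have "eventually (\<lambda>m. dist (ps m) p < r) sequentially" "eventually (\<lambda>m. dist (qs m) q < r') sequentially"
    using lim r(1) r'(1) tendstoD by blast+
  with ev show ?thesis
  proof eventually_elim
    case (elim m)
    then have "ps m \<in> C" "qs m \<in> C" by (auto simp: C_def dist_commute)
    moreover have "C \<subseteq> {x. F (us m) x < M}" using elim by auto
    ultimately show ?case unfolding connected_component_def using conn by blast
  qed
qed

text \<open>In a compact set a component is the intersection of its relatively clopen
  neighbourhoods. One of these, \<open>L\<close>, misses \<open>q\<close>, and normality separates
  the closed sets \<open>L\<close> and \<open>K - L\<close>.\<close>

lemma compact_separate_components:
  fixes K :: "'a::euclidean_space set"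
  assumes K: "compact K" and pq: "p \<in> K" "q \<in> K" "\<not> connected_component K p q"
  obtains V W where "open V" "open W" "V \<inter> W = {}" "K \<subseteq> V \<union> W" "p \<in> V" "q \<in> W"
proof -
  let ?C = "connected_component_set K p"
  have C: "?C \<in> components K" using pq(1) by (simp add: componentsI)
  have "compact ?C" using compact_components[OF K C] .
  moreover have "open (- {q})" "?C \<subseteq> - {q}" using pq by auto
  ultimately obtain L where L: "openin (top_of_set K) L" "compact L" "?C \<subseteq> L" "L \<subseteq> - {q}"
    using Sura_Bura_clopen_subset[OF closed_imp_locally_compact[OF compact_imp_closed[OF K]] C] by metis
  obtain O1 where O1: "open O1" "L = K \<inter> O1" using L(1) by (auto simp: openin_open)
  have "closed (K - O1)" using K O1 compact_imp_closed by blast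
  moreover have "closed L" using L compact_imp_closed by blast
  moreover have "L \<inter> (K - O1) = {}" using O1 by blast
  ultimately obtain V W where "open V" "open W" "L \<subseteq> V" "K - O1 \<subseteq> W" "V \<inter> W = {}"
    using separation_normal by metis
  moreover have "p \<in> L" using L(3) pq by auto
  moreover have "q \<in> K - O1" using L(4) O1 pq by auto
  ultimately show ?thesis using that[of V W] O1 by blast
qed

text \<open>By Sura-Bura, two points in different components of a compact level set are separated by disjoint
  open sets, and these still contain all nearby level sets.\<close>

lemma connected_component_sublevel_limit:
  fixes F :: "'u::metric_space \<Rightarrow> complex \<Rightarrow> real"
  assumes F: "continuous_on UNIV (\<lambda>(u, x). F u x)"
    and bdd: "bounded {x. \<exists>m. F (us m) x \<le> M}" "bounded {x. F u x \<le> M}"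
    and lim: "us \<longlonglongrightarrow> u" "ps \<longlonglongrightarrow> p" "qs \<longlonglongrightarrow> q"
    and cc: "\<And>m. connected_component {x. F (us m) x < M} (ps m) (qs m)"
  shows "connected_component {x. F u x \<le> M} p q"
proof (rule ccontr)
  assume nc: "\<not> ?thesis"
  let ?K = "{x. F u x \<le> M}"
  have limF: "(\<lambda>m. F (us (s m)) (x m)) \<longlonglongrightarrow> F u y" if "x \<longlonglongrightarrow> y" "filterlim s at_top sequentially" for x y s
  proof -
    have "(\<lambda>m. us (s m)) \<longlonglongrightarrow> u" using filterlim_compose[OF lim(1) that(2)] .
    then have "(\<lambda>m. (us (s m), x m)) \<longlonglongrightarrow> (u, y)"
      using that by (intro tendsto_Pair)
    then show ?thesis using continuous_on_tendsto_compose[OF F] by fastforce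
  qed
  have cFu: "continuous_on UNIV (F u)"
  proof -
    have "continuous_on UNIV (\<lambda>x. (\<lambda>(u, x). F u x) (u, x))"
      by (intro continuous_on_compose2[OF F] continuous_intros) auto
    then show ?thesis by simp
  qed
  have "closed ?K" by (intro closed_Collect_le continuous_intros cFu)
  then have K: "compact ?K" using bdd compact_eq_bounded_closed by blast
  have mem: "F (us m) (ps m) < M" "F (us m) (qs m) < M" for m
    using cc[of m] connected_component_in by fastforce+
  have "p \<in> ?K" "q \<in> ?K"
    using LIMSEQ_le_const2[OF limF[OF lim(2) filterlim_ident]] LIMSEQ_le_const2[OF limF[OF lim(3) filterlim_ident]] mem less_imp_le
    by blast+
  then obtain V W where VW: "open V" "open W" "V \<inter> W = {}" "?K \<subseteq> V \<union> W" "p \<in> V" "q \<in> W"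
    using compact_separate_components[OF K _ _ nc] by metis
  have ev: "eventually (\<lambda>m. {x. F (us m) x \<le> M} \<subseteq> V \<union> W) sequentially"
  proof (rule ccontr)
    assume "\<not> ?thesis"
    then have "\<exists>m\<ge>N. \<not> {x. F (us m) x \<le> M} \<subseteq> V \<union> W" for N
      unfolding eventually_sequentially by blast
    then have "\<exists>m\<ge>N. \<exists>x. x \<notin> V \<union> W \<and> F (us m) x \<le> M" for N
      by (metis (mono_tags, lifting) mem_Collect_eq subsetI)
    then obtain m x where m: "\<And>N. m N \<ge> N" "\<And>N. x N \<notin> V \<union> W" "\<And>N. F (us (m N)) (x N) \<le> M"
      by metis
    \<comment> \<open>The bound is uniform in \<open>m\<close>; without it the points outside
      \<open>V \<union> W\<close> could escape to infinity instead of accumulating at a point of the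
      limit level set.\<close>
    define S where "S = closure {x. \<exists>m. F (us m) x \<le> M}"
    have "x N \<in> S" for N
      unfolding S_def by (rule subsetD[OF closure_subset]) (use m(3) in blast)
    moreover have "compact S" using bdd unfolding S_def by simp
    ultimately obtain y r where y: "strict_mono r" "(x \<circ> r) \<longlonglongrightarrow> y"
      unfolding compact_def by blast
    have "filterlim m at_top sequentially"
      using m(1) by (intro filterlim_at_top_mono[OF filterlim_ident]) auto
    then have "filterlim (\<lambda>N. m (r N)) at_top sequentially"
      using filterlim_compose[OF _ filterlim_subseq[OF y(1)]] by blast
    then have "F u y \<le> M"
      using LIMSEQ_le_const2[OF limF[OF y(2)]] m(3) by auto
    moreover have "y \<in> - (V \<union> W)"
    proof (rule closed_sequentially)
      show "closed (- (V \<union> W))" using VW by blast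
      show "(x \<circ> r) \<longlonglongrightarrow> y" by (rule y)
      show "\<And>n. (x \<circ> r) n \<in> - (V \<union> W)" using m by auto
    qed
    ultimately show False using VW(4) by blast
  qed
  have "eventually (\<lambda>m. ps m \<in> V) sequentially" "eventually (\<lambda>m. qs m \<in> W) sequentially"
    using lim VW topological_tendstoD by blast+
  with ev have "eventually (\<lambda>m. False) sequentially"
  proof eventually_elim
    case (elim m)
    let ?C = "connected_component_set {x. F (us m) x < M} (ps m)"
    have "?C \<subseteq> {x. F (us m) x < M}" by (rule connected_component_subset)
    then have "?C \<subseteq> {x. F (us m) x \<le> M}" by auto
    moreover have "ps m \<in> ?C" "qs m \<in> ?C" using cc[of m] mem[of m] by auto
    ultimately have "V \<inter> ?C = {} \<or> W \<inter> ?C = {}"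
      using elim(1) VW(3) by (intro connectedD[OF connected_connected_component VW(1,2)]) auto
    then show False using \<open>ps m \<in> ?C\<close> \<open>qs m \<in> ?C\<close> elim(2,3) by blast
  qed
  then show False by simp
qed

section \<open>Polynomials with prescribed critical points\<close>

text \<open>The formal antiderivative normalised to vanish at 0. The constant of integration is a
  separate parameter throughout.\<close>

definition pint :: "complex poly \<Rightarrow> complex poly" where
  "pint p = (\<Sum>k\<le>degree p. monom (coeff p k / of_nat (Suc k)) (Suc k))"

lemma coeff_pint: "coeff (pint p) k = (if k = 0 then 0 else coeff p (k - 1) / of_nat k)"
proof (cases k)
  case 0
  then show ?thesis by (simp add: pint_def coeff_sum)
next
  case (Suc i)
  have "coeff (pint p) k = (\<Sum>l\<le>degree p. if l = i then coeff p l / of_nat (Suc l) else 0)"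
    unfolding pint_def coeff_sum Suc by (intro sum.cong) auto
  also have "\<dots> = (if i \<le> degree p then coeff p i / of_nat (Suc i) else 0)"
    by (subst sum.delta) auto
  also have "\<dots> = coeff p i / of_nat (Suc i)"
    by (simp add: coeff_eq_0)
  finally show ?thesis using Suc by simp
qed

lemma pderiv_pint [simp]: "pderiv (pint p) = p"
  by (rule poly_eqI) (simp add: coeff_pderiv coeff_pint del: of_nat_Suc)

lemma poly_pint_0 [simp]: "poly (pint p) 0 = 0"
  by (simp add: poly_0_coeff_0 coeff_pint)

lemma eq_const_add_pint: "pderiv q = p \<Longrightarrow> q = [:coeff q 0:] + pint p"
proof (rule poly_eqI)
  fix k assume q: "pderiv q = p"
  show "coeff q k = coeff ([:coeff q 0:] + pint p) k"
    by (cases k) (simp_all add: coeff_pint coeff_pderiv q[symmetric] del: of_nat_Suc)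
qed

lemma pint_add: "pint (p + q) = pint p + pint q"
  by (rule poly_eqI) (simp add: coeff_pint add_divide_distrib)

lemma pint_smult: "pint (smult c p) = smult c (pint p)"
  by (rule poly_eqI) (simp add: coeff_pint)

lemma pint_0 [simp]: "pint 0 = 0"
  by (simp add: pint_def)

lemma pint_sum: "pint (\<Sum>i\<in>A. f i) = (\<Sum>i\<in>A. pint (f i))"
  by (induction A rule: infinite_finite_induct) (auto simp: pint_add)

lemma poly_pint_altdef:
  assumes "degree p \<le> N"
  shows "poly (pint p) x = (\<Sum>k\<le>N. coeff p k / of_nat (Suc k) * x ^ Suc k)"
proof -
  have "poly (pint p) x = (\<Sum>k\<le>degree p. coeff p k / of_nat (Suc k) * x ^ Suc k)"
    unfolding pint_def poly_sum poly_monom ..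
  also have "\<dots> = (\<Sum>k\<le>N. coeff p k / of_nat (Suc k) * x ^ Suc k)"
    using assms by (intro sum.mono_neutral_left) (auto simp: coeff_eq_0)
  finally show ?thesis .
qed

lemma degree_pint: "p \<noteq> 0 \<Longrightarrow> degree (pint p) = Suc (degree p)"
proof -
  assume "p \<noteq> 0"
  have "degree (pint p) \<noteq> 0"
  proof
    assume "degree (pint p) = 0"
    then have "pderiv (pint p) = 0" by (simp add: pderiv_eq_0_iff del: pderiv_pint)
    then show False using \<open>p \<noteq> 0\<close> by simp
  qed
  then show ?thesis using degree_pderiv[of "pint p"] by simp
qed

definition nodal :: "nat \<Rightarrow> (nat \<Rightarrow> nat) \<Rightarrow> (nat \<Rightarrow> complex) \<Rightarrow> complex poly" where
  "nodal n m z = (\<Prod>i<n. [:- z i, 1:] ^ m i)"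

text \<open>The polynomial with constant term \<open>snd u\<close> whose derivative vanishes at \<open>fst u i\<close> to order \<open>m i\<close>,
  for \<open>i < n\<close>. The entries of \<open>fst u\<close> from \<open>n\<close> on are irrelevant.\<close>

definition crit_poly :: "nat \<Rightarrow> (nat \<Rightarrow> nat) \<Rightarrow> (nat \<Rightarrow> complex) \<times> complex \<Rightarrow> complex poly" where
  "crit_poly n m u = [:snd u:] + pint (nodal n m (fst u))"

lemma nodal_nonzero [simp]: "nodal n m z \<noteq> 0"
  by (simp add: nodal_def)

lemma degree_nodal: "degree (nodal n m z) = (\<Sum>i<n. m i)"
  unfolding nodal_def by (subst degree_prod_eq_sum_degree) (auto simp: degree_power_eq)

lemma pderiv_crit_poly [simp]: "pderiv (crit_poly n m u) = nodal n m (fst u)"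
  by (simp add: crit_poly_def pderiv_add pderiv_pCons)

lemma degree_crit_poly: "degree (crit_poly n m u) = Suc (\<Sum>i<n. m i)"
proof -
  have "degree (crit_poly n m u) = degree (pint (nodal n m (fst u)))"
    unfolding crit_poly_def by (rule degree_add_eq_right) (simp add: degree_pint)
  then show ?thesis by (simp add: degree_pint degree_nodal)
qed

text \<open>The range of summation does not depend on \<open>u\<close>, so that continuity and
  bounds in \<open>u\<close> reduce to the coefficients of the nodal polynomial.\<close>

lemma poly_crit_poly:
  "poly (crit_poly n m u) x
     = snd u + (\<Sum>k\<le>(\<Sum>i<n. m i). coeff (nodal n m (fst u)) k / of_nat (Suc k) * x ^ Suc k)"
  unfolding crit_poly_def poly_add using degree_nodal
  by (subst poly_pint_altdef[where N = "\<Sum>i<n. m i"]) auto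

lemma poly_nodal_eq_0_iff: "poly (nodal n m z) x = 0 \<longleftrightarrow> (\<exists>i<n. x = z i \<and> m i > 0)"
  by (auto simp: nodal_def poly_prod)

section \<open>Dependence of the coefficients and critical values on the parameters\<close>

lemma continuous_on_coeff_mult:
  fixes p q :: "'a::topological_space \<Rightarrow> complex poly"
  assumes "\<And>k. continuous_on A (\<lambda>u. coeff (p u) k)" "\<And>k. continuous_on A (\<lambda>u. coeff (q u) k)"
  shows "continuous_on A (\<lambda>u. coeff (p u * q u) k)"
  unfolding coeff_mult by (intro continuous_intros assms)

lemma continuous_on_coeff_power:
  fixes p :: "'a::topological_space \<Rightarrow> complex poly"
  assumes "\<And>k. continuous_on A (\<lambda>u. coeff (p u) k)"
  shows "continuous_on A (\<lambda>u. coeff (p u ^ e) k)"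
  by (induction e arbitrary: k) (auto intro!: continuous_on_coeff_mult assms)

lemma continuous_on_coeff_nodal: "continuous_on A (\<lambda>z. coeff (nodal n m z) k)"
proof (induction n arbitrary: k)
  case 0
  then show ?case by (simp add: nodal_def)
next
  case (Suc n)
  have "continuous_on A (\<lambda>z. coeff [:- z n, 1:] k)" for k and A :: "(nat \<Rightarrow> complex) set"
  proof (cases k)
    case 0
    have "continuous_on A (\<lambda>z::nat \<Rightarrow> complex. z n)"
      by (rule continuous_on_subset[OF continuous_on_product_coordinates subset_UNIV])
    then show ?thesis using 0 by (auto intro!: continuous_intros)
  next
    case (Suc l)
    then show ?thesis by (simp add: coeff_pCons)
  qed
  then show ?case
    using Suc unfolding nodal_def by (auto intro!: continuous_on_coeff_mult continuous_on_coeff_power)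
qed

lemma continuous_on_crit_poly: "continuous_on UNIV (\<lambda>(u, x). poly (crit_poly n m u) x)"
proof -
  have "continuous_on UNIV (\<lambda>y :: ((nat \<Rightarrow> complex) \<times> complex) \<times> complex. coeff (nodal n m (fst (fst y))) k)" for k
    by (rule continuous_on_compose2[OF continuous_on_coeff_nodal[of UNIV] continuous_on_fst[OF continuous_on_fst[OF continuous_on_id]]]) auto
  then show ?thesis
    unfolding poly_crit_poly case_prod_beta by (intro continuous_intros) (auto simp del: of_nat_Suc)
qed

text \<open>Differentiability at 0 of a curve of polynomials, taken coefficientwise; for bounded
  degree this is enough to differentiate its evaluations.\<close>

definition coeff_deriv :: "(complex \<Rightarrow> complex poly) \<Rightarrow> complex poly \<Rightarrow> bool" where
  "coeff_deriv p p' \<longleftrightarrow> (\<forall>k. ((\<lambda>s. coeff (p s) k) has_field_derivative coeff p' k) (at 0))"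

lemma coeff_deriv_const: "coeff_deriv (\<lambda>_. p) 0"
  by (simp add: coeff_deriv_def)

lemma coeff_deriv_mult:
  assumes "coeff_deriv p p'" "coeff_deriv q q'"
  shows "coeff_deriv (\<lambda>s. p s * q s) (p' * q 0 + p 0 * q')"
  unfolding coeff_deriv_def coeff_mult coeff_add
proof
  fix k
  have "((\<lambda>s. \<Sum>i\<le>k. coeff (p s) i * coeff (q s) (k - i)) has_field_derivative
      (\<Sum>i\<le>k. coeff p' i * coeff (q 0) (k - i) + coeff q' (k - i) * coeff (p 0) i)) (at 0)"
    by (rule DERIV_sum, rule DERIV_mult) (use assms coeff_deriv_def in blast)+
  then show "((\<lambda>s. \<Sum>i\<le>k. coeff (p s) i * coeff (q s) (k - i)) has_field_derivative
      (\<Sum>i\<le>k. coeff p' i * coeff (q 0) (k - i)) + (\<Sum>i\<le>k. coeff (p 0) i * coeff q' (k - i))) (at 0)"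
    by (simp add: sum.distrib mult.commute)
qed

lemma coeff_deriv_linear_power:
  "coeff_deriv (\<lambda>s. [:- (a + s * b), 1:] ^ e) (smult (- of_nat e * b) ([:- a, 1:] ^ (e - 1)))"
proof (induction e)
  case 0
  then show ?case using coeff_deriv_const[of 1] by simp
next
  case (Suc e)
  have "((\<lambda>s. coeff [:- (a + s * b), 1:] k) has_field_derivative coeff [:- b:] k) (at 0)" for k
  proof (cases k)
    case 0
    then show ?thesis by (auto intro!: derivative_eq_intros)
  next
    case (Suc l)
    then show ?thesis by (simp add: coeff_pCons)
  qed
  then have "coeff_deriv (\<lambda>s. [:- (a + s * b), 1:]) [:- b:]"
    by (simp add: coeff_deriv_def)
  from coeff_deriv_mult[OF this Suc]
  have "coeff_deriv (\<lambda>s. [:- (a + s * b), 1:] ^ Suc e)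
     ([:- b:] * [:- a, 1:] ^ e + [:- a, 1:] * smult (- of_nat e * b) ([:- a, 1:] ^ (e - 1)))"
    by simp
  moreover have "[:- b:] * [:- a, 1:] ^ e + [:- a, 1:] * smult (- of_nat e * b) ([:- a, 1:] ^ (e - 1))
      = smult (- of_nat (Suc e) * b) ([:- a, 1:] ^ (Suc e - 1))"
  proof (cases e)
    case 0
    then show ?thesis by simp
  next
    case (Suc e')
    have "[:- a, 1:] * smult (- of_nat e * b) ([:- a, 1:] ^ (e - 1)) = smult (- of_nat e * b) ([:- a, 1:] ^ e)"
      by (simp add: Suc)
    moreover have "[:- b:] * [:- a, 1:] ^ e = smult (- b) ([:- a, 1:] ^ e)" by simp
    ultimately show ?thesis by (simp add: smult_add_left[symmetric] algebra_simps del: smult_minus_left)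
  qed
  ultimately show ?case by simp
qed

lemma coeff_deriv_prod:
  assumes "finite A" "\<And>i. i \<in> A \<Longrightarrow> coeff_deriv (f i) (f' i)"
  shows "coeff_deriv (\<lambda>s. \<Prod>i\<in>A. f i s) (\<Sum>k\<in>A. f' k * (\<Prod>i\<in>A - {k}. f i 0))"
  using assms
proof (induction A rule: finite_induct)
  case empty
  then show ?case using coeff_deriv_const[of 1] by simp
next
  case (insert a A)
  have "coeff_deriv (\<lambda>s. f a s * (\<Prod>i\<in>A. f i s))
      (f' a * (\<Prod>i\<in>A. f i 0) + f a 0 * (\<Sum>k\<in>A. f' k * (\<Prod>i\<in>A - {k}. f i 0)))"
    using insert by (intro coeff_deriv_mult) auto
  moreover have "f a 0 * (\<Sum>k\<in>A. f' k * (\<Prod>i\<in>A - {k}. f i 0))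
      = (\<Sum>k\<in>A. f' k * (\<Prod>i\<in>insert a A - {k}. f i 0))"
    unfolding sum_distrib_left
  proof (rule sum.cong)
    fix k assume "k \<in> A"
    then have "insert a A - {k} = insert a (A - {k})" using insert by auto
    then show "f a 0 * (f' k * (\<Prod>i\<in>A - {k}. f i 0)) = f' k * (\<Prod>i\<in>insert a A - {k}. f i 0)"
      using insert by (simp add: mult.left_commute)
  qed simp
  moreover have "insert a A - {a} = A" using insert by auto
  ultimately show ?case using insert by simp
qed

text \<open>In the chain rule the motion of the evaluation point is multiplied by the derivative of
  \<open>p 0\<close> there, which vanishes at a critical point. A critical value therefore changes
  only through the polynomial, not through the speed \<open>x'\<close>.\<close>

lemma coeff_deriv_poly:
  assumes p: "coeff_deriv p p'" and deg: "\<And>s. degree (p s) \<le> N"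
    and x: "(x has_field_derivative x') (at 0)" and crit: "poly (pderiv (p 0)) (x 0) = 0"
  shows "((\<lambda>s. poly (p s) (x s)) has_field_derivative poly p' (x 0)) (at 0)"
proof -
  have alt: "poly q y = (\<Sum>k\<le>N. coeff q k * y ^ k)" if "degree q \<le> N" for q :: "complex poly" and y
    unfolding poly_altdef using that by (intro sum.mono_neutral_left) (auto simp: coeff_eq_0)
  have "degree p' \<le> N"
  proof (rule degree_le, intro allI impI)
    fix k assume "N < k"
    then have "(\<lambda>s. coeff (p s) k) = (\<lambda>s. 0)" 
      using deg by (intro ext coeff_eq_0) (rule le_less_trans)
    moreover have "((\<lambda>s. coeff (p s) k) has_field_derivative coeff p' k) (at 0)"
      using p unfolding coeff_deriv_def by blast
    ultimately have "((\<lambda>s. 0) has_field_derivative coeff p' k) (at 0)" by simp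
    then show "coeff p' k = 0" using DERIV_unique DERIV_const by blast
  qed
  \<comment> \<open>Splitting off \<open>p 0\<close> leaves coefficients that vanish at
    \<open>s = 0\<close>, so the derivatives of the powers of \<open>x s\<close> drop out.\<close>
  have "((\<lambda>s. poly (p 0) (x s) + (\<Sum>k\<le>N. (coeff (p s) k - coeff (p 0) k) * x s ^ k)) has_field_derivative
      poly (pderiv (p 0)) (x 0) * x' + (\<Sum>k\<le>N. (coeff p' k - 0) * x 0 ^ k
        + of_nat k * (x' * x 0 ^ (k - Suc 0)) * (coeff (p 0) k - coeff (p 0) k))) (at 0)"
    using p unfolding coeff_deriv_def
    by (intro DERIV_add DERIV_sum DERIV_mult DERIV_diff DERIV_const DERIV_power x DERIV_chain'[OF x poly_DERIV]) auto
  moreover have "(\<Sum>k\<le>N. (coeff p' k - 0) * x 0 ^ k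
        + of_nat k * (x' * x 0 ^ (k - Suc 0)) * (coeff (p 0) k - coeff (p 0) k)) = poly p' (x 0)"
    using alt[OF \<open>degree p' \<le> N\<close>] by simp
  moreover have "poly (p 0) (x s) + (\<Sum>k\<le>N. (coeff (p s) k - coeff (p 0) k) * x s ^ k) = poly (p s) (x s)" for s
    by (simp add: alt[OF deg] left_diff_distrib sum_subtractf)
  ultimately show ?thesis using crit by simp
qed

text \<open>The partial derivative of \<open>nodal n m z\<close> with respect to \<open>z k\<close>.\<close>

definition nodal_deriv :: "nat \<Rightarrow> (nat \<Rightarrow> nat) \<Rightarrow> (nat \<Rightarrow> complex) \<Rightarrow> nat \<Rightarrow> complex poly" where
  "nodal_deriv n m z k =
     smult (- of_nat (m k)) ([:- z k, 1:] ^ (m k - 1) * (\<Prod>i\<in>{..<n} - {k}. [:- z i, 1:] ^ m i))"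

text \<open>Here \<open>d\<close> and \<open>e\<close> are the speeds of the critical points and of
  the constant term. The evaluation point follows its critical point, so only the change of the
  polynomial contributes.\<close>

lemma crit_value_deriv:
  assumes i: "i < n" "m i > 0"
  shows "((\<lambda>s. poly (crit_poly n m (\<lambda>l. z l + s * d l, c + s * e)) (z i + s * d i)) has_field_derivative
      e + (\<Sum>k<n. d k * poly (pint (nodal_deriv n m z k)) (z i))) (at 0)"
proof -
  have *: "coeff_deriv (\<lambda>s. nodal n m (\<lambda>l. z l + s * d l)) (\<Sum>k<n. smult (d k) (nodal_deriv n m z k))"
  proof -
    have "coeff_deriv (\<lambda>s. nodal n m (\<lambda>l. z l + s * d l))
       (\<Sum>k<n. smult (- of_nat (m k) * d k) ([:- z k, 1:] ^ (m k - 1)) * (\<Prod>i\<in>{..<n} - {k}. [:- (z i + 0 * d i), 1:] ^ m i))"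
      unfolding nodal_def by (intro coeff_deriv_prod coeff_deriv_linear_power) auto
    then show ?thesis by (simp add: nodal_deriv_def mult.commute)
  qed
  have "coeff_deriv (\<lambda>s. crit_poly n m (\<lambda>l. z l + s * d l, c + s * e))
      ([:e:] + pint (\<Sum>k<n. smult (d k) (nodal_deriv n m z k)))"
    unfolding coeff_deriv_def
  proof
    fix k
    show "((\<lambda>s. coeff (crit_poly n m (\<lambda>l. z l + s * d l, c + s * e)) k) has_field_derivative
         coeff ([:e:] + pint (\<Sum>k<n. smult (d k) (nodal_deriv n m z k))) k) (at 0)"
    proof (cases k)
      case 0
      then show ?thesis by (auto simp: crit_poly_def coeff_pint intro!: derivative_eq_intros)
    next
      case (Suc l)
      have "((\<lambda>s. coeff (nodal n m (\<lambda>l. z l + s * d l)) l / of_nat k) has_field_derivative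
         coeff (\<Sum>k<n. smult (d k) (nodal_deriv n m z k)) l / of_nat k) (at 0)"
        using * unfolding coeff_deriv_def by (intro DERIV_cdivide) auto
      then show ?thesis using Suc by (simp add: crit_poly_def coeff_pint coeff_pCons)
    qed
  qed
  then have "((\<lambda>s. poly (crit_poly n m (\<lambda>l. z l + s * d l, c + s * e)) (z i + s * d i)) has_field_derivative
      poly ([:e:] + pint (\<Sum>k<n. smult (d k) (nodal_deriv n m z k))) (z i + 0 * d i)) (at 0)"
  proof (rule coeff_deriv_poly)
    show "degree (crit_poly n m (\<lambda>l. z l + s * d l, c + s * e)) \<le> Suc (\<Sum>i<n. m i)" for s
      by (simp add: degree_crit_poly)
    show "((\<lambda>s. z i + s * d i) has_field_derivative d i) (at 0)"
      by (auto intro!: derivative_eq_intros)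
    show "poly (pderiv (crit_poly n m (\<lambda>l. z l + 0 * d l, c + 0 * e))) (z i + 0 * d i) = 0"
      using i by (auto simp: poly_nodal_eq_0_iff)
  qed
  then show ?thesis by (simp add: pint_sum pint_smult poly_sum)
qed

section \<open>Interpolation at the critical points\<close>

lemma prod_linear_powers_dvd:
  fixes q :: "complex poly"
  assumes "finite A" "inj_on z A" "\<And>i. i \<in> A \<Longrightarrow> [:- z i, 1:] ^ m i dvd q"
  shows "(\<Prod>i\<in>A. [:- z i, 1:] ^ m i) dvd q"
  using assms
proof (induction A rule: finite_induct)
  case empty
  then show ?case by simp
next
  case (insert a A)
  let ?b = "\<Prod>i\<in>A. [:- z i, 1:] ^ m i"
  have "?b dvd q" using insert by auto
  then obtain r where r: "q = ?b * r" by (elim dvdE)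
  have "z a \<noteq> z i" if "i \<in> A" for i using insert that by auto
  then have "poly ?b (z a) \<noteq> 0" using insert by (simp add: poly_prod)
  then have ord: "order (z a) ?b = 0" by (rule order_0I)
  have "[:- z a, 1:] ^ m a dvd r"
  proof (cases "r = 0")
    case False
    have "?b \<noteq> 0" using insert by simp
    then have "order (z a) q = order (z a) r" using r ord False order_mult[of ?b r "z a"] by simp
    moreover have "m a \<le> order (z a) q"
      using insert(5)[of a] r False \<open>?b \<noteq> 0\<close> by (simp add: order_divides)
    ultimately show ?thesis using order_divides by metis
  qed simp
  then have "?b * [:- z a, 1:] ^ m a dvd q" unfolding r by (rule mult_dvd_mono[OF dvd_refl])
  then show ?case using insert by (simp add: mult.commute)
qed

text \<open>A Chinese remainder argument. The product \<open>G\<close> of the other factors, scaled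
  to a polynomial \<open>H\<close> with value 1 at \<open>z i\<close>, gives
  \<open>1 - (1 - H) ^ m i\<close>: it agrees with 1 to order \<open>m i\<close> at
  \<open>z i\<close> and is still divisible by \<open>H\<close>, hence vanishes to the required
  order at the other points.\<close>

lemma hermite_interpolation_constants:
  fixes z e :: "nat \<Rightarrow> complex"
  assumes z: "inj_on z {..<n}" and m: "\<And>i. i < n \<Longrightarrow> m i > 0" and n: "n > 0"
  shows "\<exists>D. degree D < (\<Sum>i<n. m i) \<and> (\<forall>i<n. [:- z i, 1:] ^ m i dvd D - [:e i:])"
proof -
  have "\<exists>L. [:- z i, 1:] ^ m i dvd L - 1 \<and> (\<forall>k<n. k \<noteq> i \<longrightarrow> [:- z k, 1:] ^ m k dvd L)" if i: "i < n" for i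
  proof -
    define G where "G = (\<Prod>k\<in>{..<n} - {i}. [:- z k, 1:] ^ m k)"
    have zk: "z i \<noteq> z k" if "k \<in> {..<n} - {i}" for k
      using that i z by (auto simp: inj_on_def)
    have "poly G (z i) = (\<Prod>k\<in>{..<n} - {i}. (z i - z k) ^ m k)"
      unfolding G_def poly_prod by (rule prod.cong[OF refl]) simp
    moreover have "(\<Prod>k\<in>{..<n} - {i}. (z i - z k) ^ m k) \<noteq> 0"
      using zk by (subst prod_zero_iff) simp_all
    ultimately have g: "poly G (z i) \<noteq> 0" by simp
    define H where "H = smult (1 / poly G (z i)) G"
    have "poly (1 - H) (z i) = 0" using g by (simp add: H_def)
    then have "[:- z i, 1:] dvd 1 - H" unfolding poly_eq_0_iff_dvd .
    then have 1: "[:- z i, 1:] ^ m i dvd (1 - H) ^ m i" by (rule dvd_power_same)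
    have "H dvd 1 - (1 - H) ^ l" for l
    proof (induction l)
      case (Suc l)
      have eq: "1 - (1 - H) ^ Suc l = (1 - (1 - H) ^ l) + H * (1 - H) ^ l" by (simp add: algebra_simps)
      show ?case unfolding eq by (intro dvd_add Suc dvd_triv_left)
    qed simp
    moreover have "G dvd H" by (simp add: H_def dvd_smult)
    moreover have "[:- z k, 1:] ^ m k dvd G" if "k < n" "k \<noteq> i" for k
      unfolding G_def using that by (intro dvd_prodI) auto
    ultimately have "\<forall>k<n. k \<noteq> i \<longrightarrow> [:- z k, 1:] ^ m k dvd 1 - (1 - H) ^ m i"
      by (meson dvd_trans)
    moreover have "[:- z i, 1:] ^ m i dvd (1 - (1 - H) ^ m i) - 1" using 1 by simp
    ultimately show ?thesis by blast
  qed
  then have "\<forall>i\<in>{..<n}. \<exists>L. [:- z i, 1:] ^ m i dvd L - 1 \<and> (\<forall>k<n. k \<noteq> i \<longrightarrow> [:- z k, 1:] ^ m k dvd L)"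
    by simp
  from bchoice[OF this] obtain L where "\<forall>i\<in>{..<n}. [:- z i, 1:] ^ m i dvd L i - 1 \<and>
      (\<forall>k<n. k \<noteq> i \<longrightarrow> [:- z k, 1:] ^ m k dvd L i)" ..
  then have L: "\<And>i. i < n \<Longrightarrow> [:- z i, 1:] ^ m i dvd L i - 1"
    "\<And>i k. i < n \<Longrightarrow> k < n \<Longrightarrow> k \<noteq> i \<Longrightarrow> [:- z k, 1:] ^ m k dvd L i" by auto
  define D0 where "D0 = (\<Sum>i<n. smult (e i) (L i))"
  \<comment> \<open>Reduction lowers the degree and keeps all congruences, since every
    \<open>[:- z i, 1:] ^ m i\<close> divides the modulus.\<close>
  define D where "D = D0 mod nodal n m z"
  have D0: "[:- z i, 1:] ^ m i dvd D0 - [:e i:]" if i: "i < n" for i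
  proof -
    have "D0 = smult (e i) (L i) + (\<Sum>k\<in>{..<n} - {i}. smult (e k) (L k))"
      unfolding D0_def using i by (subst sum.remove[of _ i]) auto
    then have "D0 - [:e i:] = smult (e i) (L i - 1) + (\<Sum>k\<in>{..<n} - {i}. smult (e k) (L k))"
      by (simp add: smult_diff_right)
    moreover have "[:- z i, 1:] ^ m i dvd (\<Sum>k\<in>{..<n} - {i}. smult (e k) (L k))"
      using L i by (intro dvd_sum dvd_smult) auto
    ultimately show ?thesis using L(1)[OF i] by (simp add: dvd_smult)
  qed
  have "[:- z i, 1:] ^ m i dvd D - [:e i:]" if i: "i < n" for i
  proof -
    have "[:- z i, 1:] ^ m i dvd nodal n m z" unfolding nodal_def using i by (intro dvd_prodI) auto
    moreover have "nodal n m z dvd D0 - D" unfolding D_def by (simp add: minus_mod_eq_mult_div)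
    ultimately have "[:- z i, 1:] ^ m i dvd D0 - D" by (rule dvd_trans)
    then have "[:- z i, 1:] ^ m i dvd (D0 - [:e i:]) - (D0 - D)" by (rule dvd_diff[OF D0[OF i]])
    moreover have "(a - b) - (a - c) = c - b" for a b c :: "complex poly" by simp
    ultimately show ?thesis by (simp only:)
  qed
  moreover have "degree D < (\<Sum>i<n. m i)"
  proof -
    have "(\<Sum>i<n. m i) > 0" using m n by (intro sum_pos) auto
    then show ?thesis unfolding D_def degree_nodal[of n m z, symmetric]
      using degree_mod_less[OF nodal_nonzero, of D0 n m z] by auto
  qed
  ultimately show ?thesis by blast
qed

lemma lagrange_interpolation:
  fixes E :: "complex poly"
  assumes z: "inj_on z {..<n}" and deg: "degree E < n"
  shows "E = (\<Sum>k<n. smult (poly E (z k) / (\<Prod>l\<in>{..<n} - {k}. z k - z l)) (\<Prod>l\<in>{..<n} - {k}. [:- z l, 1:]))"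
    (is "E = ?R")
proof -
  have dz: "z k \<noteq> z l" if "k < n" "l < n" "l \<noteq> k" for k l
    using that z by (auto simp: inj_on_def)
  have eval: "poly ?R (z i) = poly E (z i)" if i: "i < n" for i
  proof -
    let ?t = "\<lambda>k. poly (smult (poly E (z k) / (\<Prod>l\<in>{..<n} - {k}. z k - z l)) (\<Prod>l\<in>{..<n} - {k}. [:- z l, 1:])) (z i)"
    have "?t k = 0" if "k \<in> {..<n} - {i}" for k
      using that i by (auto simp: poly_prod)
    then have "(\<Sum>k\<in>{..<n} - {i}. ?t k) = 0" by (rule sum.neutral[OF ballI])
    then have "poly ?R (z i) = ?t i"
      unfolding poly_sum using sum.remove[of "{..<n}" i ?t] i by simp
    also have "\<dots> = poly E (z i)"
    proof -
      have "(\<Prod>l\<in>{..<n} - {i}. z i - z l) \<noteq> 0" using dz i by auto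
      then show ?thesis by (simp add: poly_prod)
    qed
    finally show ?thesis .
  qed
  have "degree ?R < n"
  proof (rule degree_sum_less)
    show "0 < n" using deg by simp
    fix k assume "k \<in> {..<n}"
    then have "degree (\<Prod>l\<in>{..<n} - {k}. [:- z l, 1:]) < n"
      by (subst degree_prod_eq_sum_degree) auto
    then show "degree (smult (poly E (z k) / (\<Prod>l\<in>{..<n} - {k}. z k - z l)) (\<Prod>l\<in>{..<n} - {k}. [:- z l, 1:])) < n"
      by (rule le_less_trans[OF degree_smult_le])
  qed
  show ?thesis
  proof (rule poly_eqI_degree[of "z ` {..<n}"])
    show "card (z ` {..<n}) > degree E" "card (z ` {..<n}) > degree ?R"
      using z deg \<open>degree ?R < n\<close> by (auto simp: card_image)
  qed (use eval in auto)
qed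

lemma power_dvd_pderiv:
  fixes b p :: "complex poly"
  assumes "b ^ Suc l dvd p"
  shows "b ^ l dvd pderiv p"
proof -
  obtain q where q: "p = b ^ Suc l * q" using assms unfolding dvd_def by blast
  have "pderiv p = b ^ l * (b * pderiv q + q * smult (of_nat (Suc l)) (pderiv b))"
    unfolding q pderiv_mult pderiv_power_Suc by (simp add: algebra_simps)
  then show ?thesis by simp
qed

text \<open>At distinct critical points, the critical values can be moved to first order in any prescribed
  direction. Interpolate the direction by a polynomial \<open>D\<close> that is constant to order \<open>m i\<close> at each
  \<open>z i\<close>. Then \<open>pderiv D\<close> is the nodal polynomial of the exponents \<open>m i - 1\<close> times a factor of degree
  below \<open>n\<close>, whose Lagrange coefficients are the speeds of the critical points.\<close>

lemma crit_value_direction: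
  assumes z: "inj_on z {..<n}" and m: "\<And>i. i < n \<Longrightarrow> m i > 0" and n: "n > 0"
  shows "\<exists>d c. (\<Sum>k<n. of_nat (m k) * d k) = 0 \<and>
    (\<forall>i<n. c + (\<Sum>k<n. d k * poly (pint (nodal_deriv n m z k)) (z i)) = e i)"
proof -
  obtain D where D0: "degree D < (\<Sum>i<n. m i) \<and> (\<forall>i<n. [:- z i, 1:] ^ m i dvd D - [:e i:])"
    using hermite_interpolation_constants[OF z m n, where e = e] ..
  have D: "degree D < (\<Sum>i<n. m i)" "\<And>i. i < n \<Longrightarrow> [:- z i, 1:] ^ m i dvd D - [:e i:]"
    using D0 by blast+
  define R where "R = (\<Prod>i<n. [:- z i, 1:] ^ (m i - 1))"
  have "[:- z i, 1:] ^ (m i - 1) dvd pderiv D" if i: "i < n" for i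
  proof -
    have "[:- z i, 1:] ^ Suc (m i - 1) dvd D - [:e i:]" using D(2)[OF i] m[OF i] by simp
    then have "[:- z i, 1:] ^ (m i - 1) dvd pderiv (D - [:e i:])" by (rule power_dvd_pderiv)
    then show ?thesis by (simp add: pderiv_diff pderiv_pCons)
  qed
  then have "R dvd pderiv D" unfolding R_def using z by (intro prod_linear_powers_dvd) auto
  then obtain E where E: "pderiv D = R * E" unfolding dvd_def by blast
  have R0: "R \<noteq> 0" by (simp add: R_def)
  have degR: "degree R + n = (\<Sum>i<n. m i)"
  proof -
    have "degree R = (\<Sum>i<n. m i - 1)"
      unfolding R_def by (subst degree_prod_eq_sum_degree) (auto simp: degree_power_eq)
    moreover have "(\<Sum>i<n. m i - 1) + (\<Sum>i<n. 1) = (\<Sum>i<n. m i)"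
      unfolding sum.distrib[symmetric] using m by (intro sum.cong) (auto simp: Suc_leI)
    ultimately show ?thesis by simp
  qed
  \<comment> \<open>The strict degree bound on \<open>D\<close> leaves \<open>E\<close> one degree
    below what Lagrange interpolation allows. The missing coefficient at \<open>n - 1\<close> is the
    sum of the Lagrange coefficients \<open>a k\<close>; its vanishing says that the weighted
    centroid stays fixed.\<close>
  have degE: "E = 0 \<or> degree E + 2 \<le> n"
  proof (cases "E = 0")
    case False
    then have "pderiv D \<noteq> 0" using E R0 by simp
    then have "degree D \<ge> 1" using pderiv_eq_0_iff[of D] by simp
    moreover have "degree R + degree E = degree D - 1"
      using E degree_mult_eq[OF R0 False] degree_pderiv[of D] by simp
    ultimately show ?thesis using D(1) degR by linarith
  qed simp
  then have degEn: "degree E < n" and cE: "coeff E (n - 1) = 0"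
    using n by (auto intro: coeff_eq_0)
  define a where "a k = poly E (z k) / (\<Prod>l\<in>{..<n} - {k}. z k - z l)" for k
  have Ea: "E = (\<Sum>k<n. smult (a k) (\<Prod>l\<in>{..<n} - {k}. [:- z l, 1:]))"
    unfolding a_def by (rule lagrange_interpolation[OF z degEn])
  have "coeff (\<Prod>l\<in>{..<n} - {k}. [:- z l, 1:]) (n - 1) = 1" if "k < n" for k
  proof -
    have "degree (\<Prod>l\<in>{..<n} - {k}. [:- z l, 1:]) = n - 1"
      using that by (subst degree_prod_eq_sum_degree) auto
    moreover have "lead_coeff (\<Prod>l\<in>{..<n} - {k}. [:- z l, 1:]) = 1"
      unfolding lead_coeff_prod by simp
    ultimately show ?thesis by simp
  qed
  then have "coeff (\<Sum>k<n. smult (a k) (\<Prod>l\<in>{..<n} - {k}. [:- z l, 1:])) (n - 1) = (\<Sum>k<n. a k)"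
    by (simp add: coeff_sum)
  then have "coeff E (n - 1) = (\<Sum>k<n. a k)" unfolding Ea[symmetric] .
  then have suma: "(\<Sum>k<n. a k) = 0" using cE by simp
  \<comment> \<open>\<open>nodal_deriv n m z k\<close> is \<open>- of_nat (m k)\<close> times
    \<open>R\<close> times the k-th Lagrange product; the division compensates for this
    factor.\<close>
  define d where "d k = - a k / of_nat (m k)" for k
  have md: "of_nat (m k) * d k = - a k" if "k < n" for k
    using m[OF that] by (simp add: d_def)
  have "(\<Sum>k<n. of_nat (m k) * d k) = 0"
    using suma by (simp add: md sum_negf)
  moreover have "(\<Sum>k<n. smult (d k) (nodal_deriv n m z k)) = pderiv D"
  proof -
    have "smult (d k) (nodal_deriv n m z k) = R * smult (a k) (\<Prod>l\<in>{..<n} - {k}. [:- z l, 1:])" if k: "k < n" for k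
    proof -
      have "(\<Prod>i\<in>{..<n} - {k}. [:- z i, 1:] ^ m i) =
          (\<Prod>i\<in>{..<n} - {k}. [:- z i, 1:] ^ (m i - 1)) * (\<Prod>l\<in>{..<n} - {k}. [:- z l, 1:])"
        unfolding prod.distrib[symmetric]
      proof (rule prod.cong[OF refl])
        fix i assume "i \<in> {..<n} - {k}"
        then have "m i = Suc (m i - 1)" using m[of i] by simp
        then show "[:- z i, 1:] ^ m i = [:- z i, 1:] ^ (m i - 1) * [:- z i, 1:]"
          by (metis power_Suc2)
      qed
      moreover have "R = [:- z k, 1:] ^ (m k - 1) * (\<Prod>i\<in>{..<n} - {k}. [:- z i, 1:] ^ (m i - 1))"
        unfolding R_def using k by (subst prod.remove[of _ k]) auto
      ultimately have "nodal_deriv n m z k = smult (- of_nat (m k)) (R * (\<Prod>l\<in>{..<n} - {k}. [:- z l, 1:]))"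
        unfolding nodal_deriv_def by (simp only: mult.assoc)
      then have "smult (d k) (nodal_deriv n m z k) = smult (- (of_nat (m k) * d k)) (R * (\<Prod>l\<in>{..<n} - {k}. [:- z l, 1:]))"
        by (simp add: mult.commute)
      then show ?thesis using md[OF k] by simp
    qed
    then have "(\<Sum>k<n. smult (d k) (nodal_deriv n m z k)) = (\<Sum>k<n. R * smult (a k) (\<Prod>l\<in>{..<n} - {k}. [:- z l, 1:]))"
      by (intro sum.cong) auto
    also have "\<dots> = R * E" unfolding sum_distrib_left[symmetric] Ea[symmetric] ..
    finally have "(\<Sum>k<n. smult (d k) (nodal_deriv n m z k)) = R * E" .
    then show ?thesis using E by simp
  qed
  then have "pint (pderiv D) = pint (\<Sum>k<n. smult (d k) (nodal_deriv n m z k))" by (rule arg_cong[OF sym])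
  then have "pint (pderiv D) = (\<Sum>k<n. smult (d k) (pint (nodal_deriv n m z k)))"
    by (simp only: pint_sum pint_smult)
  then have "(\<Sum>k<n. d k * poly (pint (nodal_deriv n m z k)) x) = poly (pint (pderiv D)) x" for x
    by (simp add: poly_sum)
  moreover have "coeff D 0 + poly (pint (pderiv D)) x = poly D x" for x
    using arg_cong[OF eq_const_add_pint[of D, OF refl], of "\<lambda>p. poly p x"] by simp
  moreover have "poly D (z i) = e i" if i: "i < n" for i
  proof -
    have "[:- z i, 1:] dvd [:- z i, 1:] ^ m i" by (rule dvd_power) (use m[OF i] in simp)
    then have "[:- z i, 1:] dvd D - [:e i:]" using D(2)[OF i] by (rule dvd_trans)
    then show ?thesis using poly_eq_0_iff_dvd[of "D - [:e i:]" "z i"] by simp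
  qed
  ultimately show ?thesis by (intro exI[of _ d] exI[of _ "coeff D 0"]) simp
qed

section \<open>Barriers through real critical points\<close>

lemma poly_holomorphic: "(\<lambda>z. poly p z) holomorphic_on S"
  for p :: "complex poly"
  unfolding poly_altdef by (intro holomorphic_intros)

text \<open>Near \<open>x\<close> the polynomial behaves like its value plus
  \<open>a * (z - x) ^ k\<close> with \<open>k \<ge> 2\<close> and \<open>a\<close> real. Some
  direction \<open>w\<close> makes the second term point vertically to the side given by
  \<open>s\<close>; since \<open>k \<ge> 2\<close>, it can be chosen with argument strictly between
  0 and pi, that is, in the upper half-plane.\<close>

lemma half_strip_barrier_start:
  fixes T :: "complex poly" and x s \<epsilon> :: real
  assumes real: "\<And>y::real. poly T (of_real y) \<in> \<real>"
    and deg: "degree T > 0" and crit: "poly (pderiv T) (of_real x) = 0"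
    and s: "s = 1 \<or> s = -1" and \<epsilon>: "\<epsilon> > 0"
  shows "\<exists>p. open_segment (of_real x) p \<union> {p} \<subseteq>
     {z. Im z > 0 \<and> \<bar>Re (poly T z) - Re (poly T (of_real x))\<bar> < \<epsilon> \<and> s * Im (poly T z) < 0}"
proof -
  define v where "v = poly T (of_real x)"
  have v: "Im v = 0" using real[of x] by (simp add: v_def complex_is_Real_iff)
  define P where "P = T - [:v:]"
  have P0: "P \<noteq> 0" using deg by (auto simp: P_def)
  have Px: "poly P (of_real x) = 0" by (simp add: P_def v_def)
  define k where "k = order (of_real x) P"
  have "pderiv P = pderiv T" by (simp add: P_def pderiv_diff pderiv_pCons)
  then have P'x: "poly (pderiv P) (of_real x) = 0" using crit by simp
  have P'0: "pderiv P \<noteq> 0" using deg \<open>pderiv P = pderiv T\<close> by (simp add: pderiv_eq_0_iff)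
  have "k = Suc (order (of_real x) (pderiv P))"
    unfolding k_def by (rule order_pderiv[OF P0 Px])
  moreover have "order (of_real x) (pderiv P) \<noteq> 0" using P'0 P'x order_root by blast
  ultimately have k: "k \<ge> 2" by simp
  obtain q where q: "P = [:- of_real x, 1:] ^ k * q" "\<not> [:- of_real x, 1:] dvd q"
    using order_decomp[OF P0, of "of_real x"] unfolding k_def by blast
  define a where "a = poly q (of_real x)"
  have a0: "a \<noteq> 0" using q(2) by (simp add: a_def poly_eq_0_iff_dvd)
  have TP: "poly T z = v + (z - of_real x) ^ k * poly q z" for z
  proof -
    have "poly T z = v + poly P z" by (simp add: P_def)
    also have "poly P z = (z - of_real x) ^ k * poly q z" by (subst q(1)) simp
    finally show ?thesis .
  qed
  have contq: "continuous (at z) (\<lambda>z. poly q z)" for z by (intro continuous_intros)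
  have "Im a = 0"
  proof -
    have "poly q (of_real y) \<in> \<real>" if "y \<noteq> x" for y :: real
    proof -
      have "poly q (of_real y) = (poly T (of_real y) - v) / of_real ((y - x) ^ k)"
        using that by (simp add: TP)
      also have "\<dots> \<in> \<real>" using real[of y] v by (intro Reals_divide Reals_diff) (auto simp: complex_is_Real_iff)
      finally show ?thesis .
    qed
    then have "eventually (\<lambda>y. Im (poly q (of_real y)) = 0) (at x)"
      by (auto simp: eventually_at_filter complex_is_Real_iff)
    then have "((\<lambda>y. Im (poly q (of_real y))) \<longlongrightarrow> 0) (at x)" by (rule tendsto_eventually)
    moreover have "((\<lambda>y. Im (poly q (of_real y))) \<longlongrightarrow> Im a) (at x)"
      unfolding a_def by (intro tendsto_intros)
    ultimately show ?thesis using tendsto_unique[OF trivial_limit_at] by metis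
  qed
  \<comment> \<open>The unit number that turns \<open>a\<close> into the vertical direction of the
    half-strip; \<open>w\<close> will be a k-th root of it.\<close>
  define u where "u = - (of_real s * \<i>) * of_real (norm a) / a"
  have nu: "norm u = 1" using a0 s by (auto simp: u_def norm_mult norm_divide)
  have ua: "u * a = - (of_real s * \<i>) * of_real (norm a)" using a0 by (simp add: u_def)
  \<comment> \<open>This keeps \<open>w\<close> off the real axis: \<open>a\<close> is real, while
    \<open>u * a\<close> is imaginary and nonzero.\<close>
  have "u \<noteq> 1"
  proof
    assume "u = 1"
    then have "Im a = - s * norm a" using ua by (simp add: complex_eq_iff)
    then show False using \<open>Im a = 0\<close> s a0 by auto
  qed
  define t where "t = Arg2pi u / of_nat k"
  have u: "u = exp (\<i> * of_real (Arg2pi u))" using Arg2pi_eq[of u] nu by simp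
  have "Arg2pi u \<noteq> 0" using u \<open>u \<noteq> 1\<close> by auto
  then have t: "0 < t" "t < pi"
  proof -
    show "0 < t" unfolding t_def using \<open>Arg2pi u \<noteq> 0\<close> Arg2pi_ge_0[of u] k by auto
    have "2 * pi \<le> real k * pi" using k by (intro mult_right_mono) auto
    then have "Arg2pi u < real k * pi" using Arg2pi_lt_2pi[of u] by linarith
    then show "t < pi" unfolding t_def using k by (simp add: divide_less_eq mult.commute)
  qed
  define w where "w = exp (\<i> * of_real t)"
  have wk: "w ^ k = u"
  proof -
    have "w ^ k = exp (of_nat k * (\<i> * of_real t))" unfolding w_def by (rule exp_of_nat_mult[symmetric])
    also have "of_nat k * (\<i> * of_real t) = \<i> * of_real (Arg2pi u)" using k by (simp add: t_def)
    finally show ?thesis using u by simp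
  qed
  have Imw: "Im w > 0" using t by (simp add: w_def Im_exp sin_gt_zero)
  have nw: "norm w = 1" by (simp add: w_def)
  obtain r where r: "r > 0" "\<And>z. dist z (of_real x) < r \<Longrightarrow> dist (poly q z) a < norm a / 2"
    using contq[of "of_real x", unfolded continuous_at_eps_delta, rule_format, of "norm a / 2"] a0
    unfolding a_def[symmetric] by auto
  \<comment> \<open>The three bounds keep \<open>poly q\<close> within \<open>norm a / 2\<close> of
    \<open>a\<close>, give \<open>\<rho> ^ k \<le> \<rho>\<close>, and keep the deviation of the
    real part below \<open>\<epsilon>\<close>.\<close>
  define \<rho>0 where "\<rho>0 = Min {r / 2, 1, \<epsilon> / norm a}"
  have \<rho>0: "\<rho>0 > 0" "\<rho>0 < r" "\<rho>0 \<le> 1" "\<rho>0 * norm a \<le> \<epsilon>"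
  proof -
    show "\<rho>0 > 0" using r(1) \<epsilon> a0 by (simp add: \<rho>0_def)
    have "\<rho>0 \<le> r / 2" unfolding \<rho>0_def by (rule Min_le) auto
    then show "\<rho>0 < r" using r(1) by simp
    show "\<rho>0 \<le> 1" unfolding \<rho>0_def by (rule Min_le) auto
    have "\<rho>0 \<le> \<epsilon> / norm a" unfolding \<rho>0_def by (rule Min_le) auto
    then show "\<rho>0 * norm a \<le> \<epsilon>" using a0 by (simp add: le_divide_eq)
  qed
  have good: "Im (of_real x + of_real \<rho> * w) > 0 \<and> \<bar>Re (poly T (of_real x + of_real \<rho> * w)) - Re v\<bar> < \<epsilon> \<and>
     s * Im (poly T (of_real x + of_real \<rho> * w)) < 0" if \<rho>: "0 < \<rho>" "\<rho> \<le> \<rho>0" for \<rho>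
  proof -
    let ?z = "of_real x + of_real \<rho> * w"
    have "dist ?z (of_real x) < r" using \<rho> \<rho>0 nw by (simp add: dist_norm norm_mult)
    then have "dist (poly q ?z) a < norm a / 2" by (rule r(2))
    define \<eta> where "\<eta> = u * (poly q ?z - a)"
    have \<eta>: "norm \<eta> < norm a / 2"
      using \<open>dist (poly q ?z) a < norm a / 2\<close> nu by (simp add: \<eta>_def norm_mult dist_norm)
    then have \<eta>': "norm \<eta> < norm a" using norm_ge_zero[of \<eta>] by linarith
    have "poly T ?z = v + (of_real \<rho> * w) ^ k * poly q ?z" by (simp add: TP)
    also have "\<dots> = v + of_real (\<rho> ^ k) * (u * a + \<eta>)"
      by (simp add: power_mult_distrib wk \<eta>_def algebra_simps)
    finally have T: "poly T ?z = v + of_real (\<rho> ^ k) * (- (of_real s * \<i>) * of_real (norm a) + \<eta>)"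
      by (simp only: ua)
    have Re: "Re (poly T ?z) - Re v = \<rho> ^ k * Re \<eta>" and Im: "Im (poly T ?z) = \<rho> ^ k * (- s * norm a + Im \<eta>)"
      unfolding T using v by simp_all
    have \<rho>k: "0 < \<rho> ^ k" "\<rho> ^ k \<le> \<rho>0"
    proof -
      show "0 < \<rho> ^ k" using \<rho> by simp
      have "\<rho> ^ k \<le> \<rho> ^ 1" using \<rho> \<rho>0 k by (intro power_decreasing) auto
      then show "\<rho> ^ k \<le> \<rho>0" using \<rho> by simp
    qed
    have "\<bar>\<rho> ^ k * Re \<eta>\<bar> = \<rho> ^ k * \<bar>Re \<eta>\<bar>" using \<rho>k by (simp add: abs_mult)
    also have "\<dots> \<le> \<rho>0 * norm \<eta>" using \<rho>k \<rho>0 abs_Re_le_cmod[of \<eta>] by (intro mult_mono) auto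
    also have "\<dots> < \<rho>0 * norm a" using \<eta>' \<rho>0 by (intro mult_strict_left_mono) auto
    also have "\<dots> \<le> \<epsilon>" by (rule \<rho>0)
    finally have 1: "\<bar>Re (poly T ?z) - Re v\<bar> < \<epsilon>" unfolding Re .
    have "s * (- s * norm a + Im \<eta>) = - norm a + s * Im \<eta>" using s by auto
    also have "\<dots> \<le> - norm a + norm \<eta>" using s abs_Im_le_cmod[of \<eta>] by auto
    also have "\<dots> < 0" using \<eta>' by simp
    finally have "\<rho> ^ k * (s * (- s * norm a + Im \<eta>)) < 0" using \<rho>k by (simp add: mult_less_0_iff)
    then have 2: "s * Im (poly T ?z) < 0" unfolding Im by (simp add: mult.left_commute)
    have 3: "Im ?z > 0" using \<rho> Imw by simp
    show ?thesis using 1 2 3 by blast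
  qed
  let ?p = "of_real x + of_real \<rho>0 * w"
  have "open_segment (of_real x) ?p \<union> {?p} \<subseteq>
     {z. Im z > 0 \<and> \<bar>Re (poly T z) - Re (poly T (of_real x))\<bar> < \<epsilon> \<and> s * Im (poly T z) < 0}"
  proof
    fix z assume z: "z \<in> open_segment (of_real x) ?p \<union> {?p}"
    have "\<exists>\<rho>. 0 < \<rho> \<and> \<rho> \<le> \<rho>0 \<and> z = of_real x + of_real \<rho> * w"
    proof (cases "z = ?p")
      case True
      then show ?thesis using \<rho>0 by auto
    next
      case False
      then obtain l where l: "0 < l" "l < 1" "z = (1 - l) *\<^sub>R of_real x + l *\<^sub>R ?p"
        using z by (auto simp: in_segment)
      have "z = of_real x + of_real (l * \<rho>0) * w"
        unfolding l(3) by (simp add: scaleR_conv_of_real algebra_simps)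
      moreover have "l * \<rho>0 \<le> \<rho>0" using l \<rho>0 by (simp add: mult_left_le_one_le)
      ultimately show ?thesis using l \<rho>0 by (intro exI[of _ "l * \<rho>0"]) auto
    qed
    then show "z \<in> {z. Im z > 0 \<and> \<bar>Re (poly T z) - Re (poly T (of_real x))\<bar> < \<epsilon> \<and> s * Im (poly T z) < 0}"
      using good unfolding v_def by blast
  qed
  then show ?thesis by blast
qed

text \<open>If the component of the preimage of a half-strip were bounded, it would map onto the half-strip,
  because the boundary of the component is mapped into the boundary of the half-strip.\<close>

lemma half_strip_barrier:
  fixes T :: "complex poly" and x s \<epsilon> :: real
  assumes real: "\<And>y::real. poly T (of_real y) \<in> \<real>"
    and deg: "degree T > 0" and crit: "poly (pderiv T) (of_real x) = 0"
    and s: "s = 1 \<or> s = -1" and \<epsilon>: "\<epsilon> > 0"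
  shows "\<exists>g. path g \<and> pathstart g = of_real x \<and> norm (pathfinish g) > R \<and> Im (pathfinish g) > 0 \<and>
     path_image g \<subseteq> insert (of_real x)
     {z. Im z > 0 \<and> \<bar>Re (poly T z) - Re (poly T (of_real x))\<bar> < \<epsilon> \<and> s * Im (poly T z) < 0}"
proof -
  define S where "S = {w. \<bar>Re w - Re (poly T (of_real x))\<bar> < \<epsilon> \<and> s * Im w < 0}"
  define \<Omega> where "\<Omega> = {z. Im z > 0 \<and> poly T z \<in> S}"
  obtain p where p: "open_segment (of_real x) p \<union> {p} \<subseteq> \<Omega>"
    using half_strip_barrier_start[OF assms] unfolding \<Omega>_def S_def by auto
  have cT: "continuous_on A (\<lambda>z. poly T z)" for A by (intro continuous_intros)
  have oS: "open S"
    unfolding S_def by (intro open_Collect_conj open_Collect_less continuous_intros)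
  have "open ((\<lambda>z. poly T z) -` S)" using oS cT by (intro open_vimage) auto
  moreover have "\<Omega> = {z. Im z > 0} \<inter> (\<lambda>z. poly T z) -` S" by (auto simp: \<Omega>_def)
  ultimately have o\<Omega>: "open \<Omega>" by (simp add: open_halfspace_Im_gt open_Int)
  define V where "V = connected_component_set \<Omega> p"
  have oV: "open V" unfolding V_def using o\<Omega> open_connected_component by blast
  have cV: "connected V" unfolding V_def by simp
  have V\<Omega>: "V \<subseteq> \<Omega>" unfolding V_def by (rule connected_component_subset)
  have pV: "p \<in> V" using p by (simp add: V_def)
  have convS: "connected S"
  proof -
    have "S = {w. Re w < Re (poly T (of_real x)) + \<epsilon>} \<inter> {w. Re w > Re (poly T (of_real x)) - \<epsilon>} \<inter>
        (if s = 1 then {w. Im w < 0} else {w. Im w > 0})"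
      using s by (auto simp: S_def)
    moreover have "convex \<dots>"
      by (auto intro!: convex_Int simp: convex_halfspace_Re_lt convex_halfspace_Re_gt convex_halfspace_Im_lt convex_halfspace_Im_gt)
    ultimately show ?thesis using convex_connected by metis
  qed
  have "\<not> bounded V"
  proof
    assume bV: "bounded V"
    \<comment> \<open>This makes the image of \<open>V\<close> relatively closed in
      \<open>S\<close>. A point of \<open>closure V\<close> with value in \<open>S\<close> is not
      real, because \<open>T\<close> is real on the real axis and \<open>S\<close> avoids it; it
      thus lies in \<open>\<Omega>\<close>, and its component meets \<open>V\<close>.\<close>
    have img: "(\<lambda>z. poly T z) ` V = S \<inter> (\<lambda>z. poly T z) ` closure V"
    proof
      show "(\<lambda>z. poly T z) ` V \<subseteq> S \<inter> (\<lambda>z. poly T z) ` closure V"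
        using V\<Omega> closure_subset by (auto simp: \<Omega>_def)
      show "S \<inter> (\<lambda>z. poly T z) ` closure V \<subseteq> (\<lambda>z. poly T z) ` V"
      proof
        fix w assume w: "w \<in> S \<inter> (\<lambda>z. poly T z) ` closure V"
        then obtain y where y: "y \<in> closure V" "w = poly T y" "poly T y \<in> S" by blast
        have "closure V \<subseteq> {z. Im z \<ge> 0}"
          by (rule closure_minimal) (use V\<Omega> in \<open>auto simp: \<Omega>_def closed_halfspace_Im_ge\<close>)
        then have "Im y \<ge> 0" using y by auto
        moreover have "Im y \<noteq> 0"
        proof
          assume "Im y = 0"
          then have "y = of_real (Re y)" by (simp add: complex_eq_iff)
          then have "Im (poly T y) = 0" using real[of "Re y"] by (simp add: complex_is_Real_iff)
          then show False using y(3) by (simp add: S_def)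
        qed
        ultimately have "y \<in> \<Omega>" using y by (simp add: \<Omega>_def)
        let ?W = "connected_component_set \<Omega> y"
        have "open ?W" "y \<in> ?W" using o\<Omega> open_connected_component \<open>y \<in> \<Omega>\<close> by auto
        then have "?W \<inter> V \<noteq> {}" using y(1) open_Int_closure_eq_empty[of ?W V] by blast
        then have "?W = V" unfolding V_def by (metis connected_component_nonoverlap)
        then show "w \<in> (\<lambda>z. poly T z) ` V" using \<open>y \<in> ?W\<close> y by blast
      qed
    qed
    have cpt: "compact ((\<lambda>z. poly T z) ` closure V)"
      using bV by (intro compact_continuous_image cT) simp
    have "closedin (top_of_set S) ((\<lambda>z. poly T z) ` V)"
      unfolding img using compact_imp_closed[OF cpt] by (rule closedin_closed_Int)
    moreover have "open ((\<lambda>z. poly T z) ` V)"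
    proof (rule open_mapping_thm[OF poly_holomorphic oV cV oV subset_refl])
      show "\<not> (\<lambda>z. poly T z) constant_on V"
      proof
        assume "(\<lambda>z. poly T z) constant_on V"
        then obtain c where c: "\<And>z. z \<in> V \<Longrightarrow> poly T z = c" by (auto simp: constant_on_def)
        have "infinite V" using oV pV not_open_singleton finite_imp_not_open by blast
        moreover have "V \<subseteq> {z. poly (T - [:c:]) z = 0}" using c by auto
        moreover have "T - [:c:] \<noteq> 0" using deg by auto
        ultimately show False using poly_roots_finite finite_subset by blast
      qed
    qed
    then have "openin (top_of_set S) ((\<lambda>z. poly T z) ` V)"
      using img by (auto simp: openin_open)
    ultimately have "(\<lambda>z. poly T z) ` V = S"
      using convS pV unfolding connected_clopen by blast
    then have "bounded S" using cpt img compact_imp_bounded bounded_subset by (metis inf_le2)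
    then obtain B where B: "\<And>w. w \<in> S \<Longrightarrow> norm w \<le> B" unfolding bounded_iff by blast
    \<comment> \<open>A point of the half-strip too far out for the supposed bound
      \<open>B\<close>.\<close>
    define w where "w = Complex (Re (poly T (of_real x))) (- s * (\<bar>B\<bar> + 1))"
    have "w \<in> S" unfolding S_def w_def using s \<epsilon> by auto
    then have "\<bar>Im w\<bar> \<le> B" using B abs_Im_le_cmod order_trans by blast
    then show False unfolding w_def using s by auto
  qed
  then obtain y where y: "y \<in> V" "norm y > R" unfolding bounded_iff by (meson not_le)
  have "path_connected V" using oV cV connected_open_path_connected by blast
  then obtain g where g: "path g" "path_image g \<subseteq> V" "pathstart g = p" "pathfinish g = y"
    using pV y unfolding path_connected_def by blast
  let ?g = "linepath (of_real x) p +++ g"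
  have "path_image ?g \<subseteq> insert (of_real x) \<Omega>"
  proof -
    have "closed_segment (of_real x) p \<subseteq> insert (of_real x) \<Omega>"
      using p by (auto simp: closed_segment_eq_open)
    then show ?thesis using g V\<Omega> by (subst path_image_join) auto
  qed
  moreover have "path ?g" using g by simp
  moreover have "Im y > 0" using y V\<Omega> by (auto simp: \<Omega>_def)
  ultimately show ?thesis using g y unfolding \<Omega>_def S_def by (intro exI[of _ ?g]) auto
qed

text \<open>A curve from \<open>y\<close> to \<open>w\<close>, prolonged along the real axis, has to cross the barriers that leave the
  critical point \<open>x\<close> into both half-planes.\<close>

lemma real_critical_points_separated:
  fixes T :: "complex poly" and x y w s \<epsilon> :: real
  assumes real: "\<And>y::real. poly T (of_real y) \<in> \<real>"
    and deg: "degree T > 0" and crit: "poly (pderiv T) (of_real x) = 0"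
    and s: "s = 1 \<or> s = -1" and \<epsilon>: "\<epsilon> > 0" and ord: "y < x" "x < w"
    and A: "\<And>a. a \<in> A \<Longrightarrow> \<bar>Re a - Re (poly T (of_real x))\<bar> < \<epsilon> \<Longrightarrow> s * Im a > 0"
  shows "\<not> path_component {z. poly T z \<in> A} (of_real y) (of_real w)"
proof
  assume "path_component {z. poly T z \<in> A} (of_real y) (of_real w)"
  then obtain c where c: "path c" "path_image c \<subseteq> {z. poly T z \<in> A}"
    "pathstart c = of_real y" "pathfinish c = of_real w"
    unfolding path_component_def by blast
  define v where "v = Re (poly T (of_real x))"
  obtain R where R: "\<And>z. z \<in> path_image c \<Longrightarrow> norm z \<le> R"
    using compact_imp_bounded[OF compact_path_image[OF c(1)]] unfolding bounded_iff by blast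
  define B where "B = {z. \<bar>Re (poly T z) - v\<bar> < \<epsilon> \<and> s * Im (poly T z) < 0}"
  have xA: "poly T (of_real x) \<notin> A"
    using A[of "poly T (of_real x)"] \<epsilon> real[of x] by (auto simp: complex_is_Real_iff)
  have BA: "z \<in> B \<Longrightarrow> poly T z \<notin> A" for z
    using A[of "poly T z"] by (auto simp: B_def v_def)
  obtain g where g: "path g" "pathstart g = of_real x" "norm (pathfinish g) > 2 * R" "Im (pathfinish g) > 0"
     "path_image g \<subseteq> insert (of_real x) {z. Im z > 0 \<and> z \<in> B}"
    using half_strip_barrier[OF real deg crit s \<epsilon>, of "2 * R"] unfolding B_def v_def by auto
  \<comment> \<open>The half-turn exchanges the half-planes and preserves values, so the barrier of
    \<open>T'\<close> at \<open>- x\<close> yields the lower barrier of \<open>T\<close> at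
    \<open>x\<close>.\<close>
  define T' where "T' = pcompose T [:0, -1:]"
  have T': "poly T' z = poly T (- z)" for z by (simp add: T'_def poly_pcompose)
  obtain h where h: "path h" "pathstart h = of_real (- x)" "norm (pathfinish h) > 2 * R" "Im (pathfinish h) > 0"
     "path_image h \<subseteq> insert (of_real (- x)) {z. Im z > 0 \<and> - z \<in> B}"
  proof -
    have "poly T' (of_real y) \<in> \<real>" for y using real[of "- y"] by (simp add: T')
    moreover have "degree T' > 0" using deg by (simp add: T'_def degree_pcompose)
    moreover have "poly (pderiv T') (of_real (- x)) = 0"
      using crit by (simp add: T'_def pderiv_pcompose poly_pcompose)
    ultimately show ?thesis
      using half_strip_barrier[of T' "- x" s \<epsilon> "2 * R"] s \<epsilon> that unfolding B_def v_def by (auto simp: T')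
  qed
  define h' where "h' t = - h t" for t
  have h': "path h'" "pathstart h' = of_real x" "norm (pathfinish h') > 2 * R" "Im (pathfinish h') < 0"
     "path_image h' \<subseteq> insert (of_real x) {z. Im z < 0 \<and> z \<in> B}"
  proof -
    show "path h'" using h(1) unfolding path_def h'_def by (intro continuous_intros)
    show "pathstart h' = of_real x" "norm (pathfinish h') > 2 * R" "Im (pathfinish h') < 0"
      using h by (simp_all add: h'_def pathstart_def pathfinish_def)
    show "path_image h' \<subseteq> insert (of_real x) {z. Im z < 0 \<and> z \<in> B}"
      using h(5) unfolding path_image_def h'_def by fastforce
  qed
  define p where "p = pathfinish g"
  define q where "q = pathfinish h'"
  have "bounded (path_image c \<union> path_image g \<union> path_image h')"
    using c g h' by (intro bounded_Un compact_imp_bounded[OF compact_path_image] conjI | simp)+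
  then obtain L0 where L0: "\<And>z. z \<in> path_image c \<union> path_image g \<union> path_image h' \<Longrightarrow> norm z \<le> L0"
    unfolding bounded_iff by blast
  define L where "L = max L0 0 + 1"
  have L: "\<bar>Re z\<bar> < L" "\<bar>Im z\<bar> < L" if "z \<in> path_image c \<union> path_image g \<union> path_image h'" for z
    using L0[OF that] abs_Re_le_cmod[of z] abs_Im_le_cmod[of z] by (auto simp: L_def)
  have mem: "of_real y \<in> path_image c" "of_real w \<in> path_image c" "p \<in> path_image g" "q \<in> path_image h'"
    using c pathstart_in_path_image pathfinish_in_path_image unfolding p_def q_def by metis+
  \<comment> \<open>In the square of half-width \<open>L\<close>, \<open>f\<close> runs from the
    left to the right side through \<open>c\<close>, and \<open>k\<close> from the bottom to the top
    through both barriers. By the Fashoda theorem they meet; the rest shows that they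
    cannot.\<close>
  define f where "f = linepath (of_real (- L)) (of_real y) +++ (c +++ linepath (of_real w) (of_real L))"
  define k where "k = linepath (Complex (Re q) (- L)) q +++ (reversepath h' +++ (g +++ linepath p (Complex (Re p) L)))"
  have pf: "path f" "path_image f = closed_segment (of_real (- L)) (of_real y) \<union> path_image c \<union> closed_segment (of_real w) (of_real L)"
    "pathstart f = of_real (- L)" "pathfinish f = of_real L"
    using c by (auto simp: f_def path_image_join)
  have pk: "path k" "path_image k = closed_segment (Complex (Re q) (- L)) q \<union> path_image h' \<union> path_image g \<union> closed_segment p (Complex (Re p) L)"
    "pathstart k = Complex (Re q) (- L)" "pathfinish k = Complex (Re p) L"
    using g h' by (auto simp: k_def path_image_join p_def q_def)
  have segr: "z \<in> closed_segment (of_real a) (of_real b) \<longleftrightarrow> Im z = 0 \<and> a \<le> Re z \<and> Re z \<le> b"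
    if "a \<le> b" for a b and z :: complex
    using that by (auto simp: closed_segment_same_Im closed_segment_eq_real_ivl)
  have segi: "z \<in> closed_segment a b \<longleftrightarrow> Re z = Re a \<and> Im a \<le> Im z \<and> Im z \<le> Im b"
    if "Im a \<le> Im b" "Re a = Re b" for a b z :: complex
    using that by (auto simp: closed_segment_same_Re closed_segment_eq_real_ivl)
  have Ly: "- L < y" "y < L" "- L < w" "w < L" "Im p < L" "- L < Im q"
  proof -
    have "\<bar>Re (complex_of_real y)\<bar> < L" by (rule L) (use mem in blast)
    then show "- L < y" "y < L" by simp_all
    have "\<bar>Re (complex_of_real w)\<bar> < L" by (rule L) (use mem in blast)
    then show "- L < w" "w < L" by simp_all
    have "\<bar>Im p\<bar> < L" "\<bar>Im q\<bar> < L" by (rule L, use mem in blast)+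
    then show "Im p < L" "- L < Im q" by simp_all
  qed
  have f_cases: "z \<in> path_image c \<or> Im z = 0 \<and> Re z \<noteq> x" if "z \<in> path_image f" for z
    using that unfolding pf segr[OF less_imp_le[OF Ly(1)]] segr[OF less_imp_le[OF Ly(4)]] Un_iff
    using ord by auto
  have k_cases: "z = of_real x \<or> Im z \<noteq> 0 \<and> z \<in> B \<or> Re z = Re q \<and> Im z \<le> Im q \<or> Re z = Re p \<and> Im p \<le> Im z"
    if "z \<in> path_image k" for z
    using that g(5) h'(5) Ly unfolding pk Un_iff by (auto simp: segi)
  have f_box: "- L \<le> Re z \<and> Re z \<le> L \<and> - L \<le> Im z \<and> Im z \<le> L" if "z \<in> path_image f" for z
    using that L[of z] Ly unfolding pf segr[OF less_imp_le[OF Ly(1)]] segr[OF less_imp_le[OF Ly(4)]] Un_iff by auto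
  have k_box: "- L \<le> Re z \<and> Re z \<le> L \<and> - L \<le> Im z \<and> Im z \<le> L" if "z \<in> path_image k" for z
  proof -
    have "z \<in> path_image h' \<union> path_image g \<or> Re z = Re q \<and> - L \<le> Im z \<and> Im z \<le> Im q \<or>
        Re z = Re p \<and> Im p \<le> Im z \<and> Im z \<le> L"
      using that Ly unfolding pk Un_iff by (auto simp: segi)
    moreover have "\<bar>Re p\<bar> < L" "\<bar>Im p\<bar> < L" "\<bar>Re q\<bar> < L" "\<bar>Im q\<bar> < L"
      using L[of p] L[of q] mem by auto
    moreover have "z \<in> path_image h' \<union> path_image g \<Longrightarrow> \<bar>Re z\<bar> < L \<and> \<bar>Im z\<bar> < L"
      using L[of z] by blast
    ultimately show ?thesis by linarith
  qed
  \<comment> \<open>The barriers end outside the disc of radius \<open>R\<close> that contains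
    \<open>c\<close>, and their vertical prolongations only lead further away from 0.\<close>
  have far: "norm z > R" if "Re z = Re q \<and> Im z \<le> Im q \<or> Re z = Re p \<and> Im p \<le> Im z" for z
  proof -
    have *: "norm b \<le> norm z" if "Re z = Re b" "\<bar>Im b\<bar> \<le> \<bar>Im z\<bar>" for b
      unfolding cmod_def using that by (intro real_sqrt_le_mono add_mono) (auto simp: abs_le_square_iff)
    have "norm q \<le> norm z \<or> norm p \<le> norm z"
      using that *[of q] *[of p] h'(4) g(4) by (auto simp: p_def q_def)
    moreover have "R \<ge> 0" using R[OF mem(1)] norm_ge_zero order_trans by blast
    ultimately show ?thesis using h'(3) g(3) by (auto simp: p_def q_def)
  qed
  have disj: "z \<notin> path_image k" if zf: "z \<in> path_image f" for z
  proof
    assume zk: "z \<in> path_image k"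
    show False
    proof (cases "z \<in> path_image c")
      case True
      then have "poly T z \<in> A" "norm z \<le> R" using c R by auto
      then show False using k_cases[OF zk] xA BA far[of z] by auto
    next
      case False
      then have "Im z = 0" "Re z \<noteq> x" using f_cases[OF zf] by auto
      then show False using k_cases[OF zk] g(4) h'(4) by (auto simp: p_def q_def)
    qed
  qed
  define \<phi> :: "complex \<Rightarrow> real^2" where "\<phi> z = Re z *\<^sub>R axis 1 1 + Im z *\<^sub>R axis 2 1" for z
  have \<phi>: "\<phi> z $ 1 = Re z" "\<phi> z $ 2 = Im z" for z
    by (simp_all add: \<phi>_def axis_def)
  have c\<phi>: "continuous_on S \<phi>" for S unfolding \<phi>_def by (intro continuous_intros)
  define bx :: "real^2" where "bx = (\<chi> i. L)"
  obtain u where u: "u \<in> path_image (\<phi> \<circ> f)" "u \<in> path_image (\<phi> \<circ> k)"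
  proof (rule fashoda[of "\<phi> \<circ> f" "\<phi> \<circ> k" "- bx" bx])
    show "path (\<phi> \<circ> f)" "path (\<phi> \<circ> k)"
      using pf pk by (auto intro!: path_continuous_image c\<phi>)
    show "path_image (\<phi> \<circ> f) \<subseteq> cbox (- bx) bx"
      unfolding path_image_compose using f_box by (auto simp: mem_box_cart forall_2 \<phi> bx_def)
    show "path_image (\<phi> \<circ> k) \<subseteq> cbox (- bx) bx"
      unfolding path_image_compose using k_box by (auto simp: mem_box_cart forall_2 \<phi> bx_def)
    show "pathstart (\<phi> \<circ> f) $ 1 = (- bx) $ 1" "pathfinish (\<phi> \<circ> f) $ 1 = bx $ 1"
      "pathstart (\<phi> \<circ> k) $ 2 = (- bx) $ 2" "pathfinish (\<phi> \<circ> k) $ 2 = bx $ 2"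
      using pf pk by (simp_all add: pathstart_compose pathfinish_compose \<phi> bx_def)
  qed
  then obtain z z' where "z \<in> path_image f" "z' \<in> path_image k" "\<phi> z = \<phi> z'"
    unfolding path_image_compose by auto
  moreover from this have "z = z'" using \<phi> by (metis complex_eqI)
  ultimately show False using disj by blast
qed

section \<open>Properness of the critical values\<close>

lemma nodal_scale: "poly (nodal n m (\<lambda>i. l * z i)) (l * x) = l ^ (\<Sum>i<n. m i) * poly (nodal n m z) x"
proof -
  have "poly (nodal n m (\<lambda>i. l * z i)) (l * x) = (\<Prod>i<n. l ^ m i * (x - z i) ^ m i)"
    unfolding nodal_def poly_prod
    by (rule prod.cong[OF refl]) (simp add: power_mult_distrib[symmetric] algebra_simps)
  also have "\<dots> = (\<Prod>i<n. l ^ m i) * (\<Prod>i<n. (x - z i) ^ m i)" by (rule prod.distrib)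
  also have "(\<Prod>i<n. l ^ m i) = l ^ (\<Sum>i<n. m i)" by (rule power_sum[symmetric])
  also have "(\<Prod>i<n. (x - z i) ^ m i) = poly (nodal n m z) x"
    unfolding nodal_def poly_prod by (rule prod.cong[OF refl]) simp
  finally show ?thesis .
qed

text \<open>As functions of \<open>x\<close>, both sides vanish at 0 and have the same
  derivative.\<close>

lemma pint_nodal_scale:
  "poly (pint (nodal n m (\<lambda>i. l * z i))) (l * x) = l ^ Suc (\<Sum>i<n. m i) * poly (pint (nodal n m z)) x"
proof -
  define q where "q = pcompose (pint (nodal n m (\<lambda>i. l * z i))) [:0, l:]"
  have "pderiv q = smult (l ^ Suc (\<Sum>i<n. m i)) (nodal n m z)"
  proof (rule poly_eq_poly_eq_iff[THEN iffD1], rule ext)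
    fix y
    have "poly (pderiv q) y = poly (nodal n m (\<lambda>i. l * z i)) (l * y) * l"
      by (simp add: q_def pderiv_pcompose poly_pcompose pderiv_pCons mult.commute)
    then show "poly (pderiv q) y = poly (smult (l ^ Suc (\<Sum>i<n. m i)) (nodal n m z)) y"
      by (simp add: nodal_scale)
  qed
  then have "q = [:coeff q 0:] + pint (smult (l ^ Suc (\<Sum>i<n. m i)) (nodal n m z))"
    by (rule eq_const_add_pint)
  moreover have "coeff q 0 = 0"
    unfolding poly_0_coeff_0[symmetric] by (simp add: q_def poly_pcompose)
  ultimately have "q = smult (l ^ Suc (\<Sum>i<n. m i)) (pint (nodal n m z))"
    by (simp add: pint_smult)
  then have "poly q x = l ^ Suc (\<Sum>i<n. m i) * poly (pint (nodal n m z)) x" by simp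
  then show ?thesis by (simp add: q_def poly_pcompose mult.commute)
qed

text \<open>If all critical values coincide, every critical point of multiplicity \<open>k\<close> is a root of multiplicity
  \<open>k + 1\<close>, and the degree leaves room for only one of them.\<close>

lemma equal_crit_values_imp_equal:
  assumes m: "\<And>i. i < n \<Longrightarrow> m i > 0" and val: "\<And>i. i < n \<Longrightarrow> poly (pint (nodal n m z)) (z i) = v"
  shows "card (z ` {..<n}) \<le> 1"
proof -
  define P where "P = pint (nodal n m z) - [:v:]"
  define A where "A = z ` {..<n}"
  have dP: "pderiv P = nodal n m z" by (simp add: P_def pderiv_diff pderiv_pCons)
  have P0: "P \<noteq> 0" using dP by auto
  have degP: "degree P \<le> Suc (\<Sum>i<n. m i)"
  proof -
    have "degree P - 1 = (\<Sum>i<n. m i)" using degree_pderiv[of P] by (simp add: dP degree_nodal)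
    then show ?thesis by linarith
  qed
  have rootsN: "{x. poly (nodal n m z) x = 0} = A"
    using m by (auto simp: poly_nodal_eq_0_iff A_def)
  have ordP: "order a P = Suc (order a (nodal n m z))" if "a \<in> A" for a
  proof -
    have "poly P a = 0" using that val by (auto simp: A_def P_def)
    then show ?thesis using order_pderiv[OF P0, of a] by (simp add: dP)
  qed
  have "(\<Sum>i<n. m i) = size (proots (nodal n m z))"
    by (simp add: size_proots_complex degree_nodal)
  also have "\<dots> = (\<Sum>a\<in>A. order a (nodal n m z))"
    by (simp add: size_multiset_overloaded_eq rootsN)
  finally have "(\<Sum>i<n. m i) + card A = (\<Sum>a\<in>A. order a P)"
    by (simp add: ordP sum_Suc)
  also have "\<dots> \<le> (\<Sum>a | poly P a = 0. order a P)"
    using poly_roots_finite[OF P0] val by (intro sum_mono2) (auto simp: A_def P_def)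
  also have "\<dots> \<le> Suc (\<Sum>i<n. m i)"
    using sum_order_le_degree[OF P0] degP by linarith
  finally show ?thesis by (simp add: A_def)
qed

text \<open>Tychonoff's theorem. With radius 0 from index \<open>n\<close> on, the irrelevant
  coordinates are frozen and sequences serve as points of an n-dimensional space.\<close>

lemma compact_polydisc:
  fixes B :: "nat \<Rightarrow> real"
  shows "compact {z :: nat \<Rightarrow> complex. \<forall>i. norm (z i) \<le> B i}"
proof -
  have "compactin (product_topology (\<lambda>_. euclidean) UNIV) (PiE UNIV (\<lambda>i. cball (0::complex) (B i)))"
    by (simp add: compactin_PiE compactin_euclidean_iff)
  then have "compact (PiE UNIV (\<lambda>i. cball (0::complex) (B i)))"
    by (simp only: euclidean_product_topology compactin_euclidean_iff)
  moreover have "PiE UNIV (\<lambda>i. cball (0::complex) (B i)) = {z. \<forall>i. norm (z i) \<le> B i}"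
    by (auto simp: PiE_def Pi_def)
  ultimately show ?thesis by simp
qed

lemma continuous_on_coord: "continuous_on S (\<lambda>z :: nat \<Rightarrow> complex. z i)"
  by (rule continuous_on_subset[OF continuous_on_product_coordinates subset_UNIV])

lemma continuous_on_fst_coord: "continuous_on S (\<lambda>u :: (nat \<Rightarrow> complex) \<times> complex. fst u i)"
  by (rule continuous_on_compose2[OF continuous_on_coord[of UNIV] continuous_on_fst[OF continuous_on_id] subset_UNIV])

lemma continuous_on_crit_value:
  "continuous_on S (\<lambda>u. poly (crit_poly n m u) (fst u i))"
proof -
  have "continuous_on S (\<lambda>u :: (nat \<Rightarrow> complex) \<times> complex. (\<lambda>(u, x). poly (crit_poly n m u) x) (u, fst u i))"
    by (rule continuous_on_compose2[OF continuous_on_crit_poly _ subset_UNIV])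
       (rule continuous_on_Pair[OF continuous_on_id continuous_on_fst_coord])
  then show ?thesis by simp
qed

lemma continuous_on_pint_nodal:
  "continuous_on S (\<lambda>z. poly (pint (nodal n m z)) (z i))"
proof -
  have "continuous_on S (\<lambda>z. poly (crit_poly n m (z, 0)) (fst (z, 0 :: complex) i))"
    by (rule continuous_on_compose2[OF continuous_on_crit_value[of UNIV] _ subset_UNIV])
       (rule continuous_on_Pair[OF continuous_on_id continuous_on_const])
  then show ?thesis by (simp add: crit_poly_def)
qed

text \<open>The critical values are homogeneous in the critical points, so it is enough to bound their spread
  from below on the unit sphere.\<close>

lemma crit_values_proper:
  assumes m: "\<And>i. i < n \<Longrightarrow> m i > 0"
  shows "\<exists>B. \<forall>z c. (\<forall>i\<ge>n. z i = 0) \<longrightarrow> (\<Sum>i<n. of_nat (m i) * z i) = 0 \<longrightarrow>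
     (\<forall>i<n. norm (poly (crit_poly n m (z, c)) (z i)) \<le> K) \<longrightarrow> (\<forall>i<n. norm (z i) \<le> B)"
proof -
  define N where "N = (\<Sum>i<n. m i)"
  \<comment> \<open>Differences to the value at \<open>z 0\<close> do not involve the constant term,
    for which no bound is assumed.\<close>
  define G where "G z = (\<Sum>i<n. norm (poly (pint (nodal n m z)) (z i) - poly (pint (nodal n m z)) (z 0)))" for z
  define S where "S = {z :: nat \<Rightarrow> complex. \<forall>i. norm (z i) \<le> (if i < n then 1 else 0)} \<inter>
     {z. (\<Sum>i<n. of_nat (m i) * z i) = 0} \<inter> (\<Union>i<n. {z. norm (z i) = 1})"
  have "closed {z :: nat \<Rightarrow> complex. (\<Sum>i<n. of_nat (m i) * z i) = 0}"
    by (intro closed_Collect_eq continuous_intros continuous_on_coord)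
  moreover have "closed (\<Union>i<n. {z :: nat \<Rightarrow> complex. norm (z i) = 1})"
    by (intro closed_UN finite_lessThan ballI closed_Collect_eq continuous_on_norm continuous_on_coord continuous_on_const)
  ultimately have cS: "compact S"
    unfolding S_def by (intro compact_Int_closed compact_polydisc)
  have cG: "continuous_on S G"
    unfolding G_def by (intro continuous_intros continuous_on_pint_nodal)
  have Gpos: "G z > 0" if z: "z \<in> S" for z
  proof (rule ccontr)
    assume "\<not> G z > 0"
    moreover have "G z \<ge> 0" unfolding G_def by (intro sum_nonneg) auto
    ultimately have "G z = 0" by simp
    then have *: "\<forall>i\<in>{..<n}. norm (poly (pint (nodal n m z)) (z i) - poly (pint (nodal n m z)) (z 0)) = 0"
      unfolding G_def by (subst (asm) sum_nonneg_eq_0_iff) (rule finite_lessThan, rule norm_ge_zero)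
    have "poly (pint (nodal n m z)) (z i) = poly (pint (nodal n m z)) (z 0)" if "i < n" for i
      using bspec[OF *, of i] that by simp
    then have c1: "card (z ` {..<n}) \<le> 1" using equal_crit_values_imp_equal[of n m z] m by blast
    obtain i where i: "i < n" "norm (z i) = 1" using z by (auto simp: S_def)
    have "z l = z i" if "l < n" for l
    proof -
      have "\<forall>a\<in>z ` {..<n}. \<forall>b\<in>z ` {..<n}. a = b"
        using c1 by (subst card_le_Suc0_iff_eq[symmetric]) auto
      then show ?thesis using that i by blast
    qed
    \<comment> \<open>Here the centroid enters: if all critical points coincide, they must be at 0,
      against the normalisation.\<close>
    then have "(\<Sum>l<n. of_nat (m l) * z l) = (\<Sum>l<n. of_nat (m l)) * z i"
      by (simp add: sum_distrib_right)
    moreover have "(\<Sum>l<n. of_nat (m l) * z l) = 0" using z by (simp add: S_def)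
    moreover have "(\<Sum>l<n. complex_of_nat (m l)) \<noteq> 0"
    proof -
      have "(\<Sum>l<n. m l) > 0" using m i by (intro sum_pos2[of _ i]) auto
      then show ?thesis unfolding of_nat_sum[symmetric] of_nat_eq_0_iff by linarith
    qed
    ultimately have "z i = 0" by simp
    then show False using i by simp
  qed
  obtain \<epsilon> where \<epsilon>: "\<epsilon> > 0" "\<And>z. z \<in> S \<Longrightarrow> \<epsilon> \<le> G z"
  proof (cases "S = {}")
    \<comment> \<open>This happens for \<open>n = 1\<close>, where the centroid condition forces the
      only critical point to be 0.\<close>
    case True
    then show ?thesis using that[of 1] by auto
  next
    case False
    then obtain z0 where "z0 \<in> S" "\<And>z. z \<in> S \<Longrightarrow> G z0 \<le> G z"
      using continuous_attains_inf[OF cS False cG] by blast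
    then show ?thesis using that[of "G z0"] Gpos by blast
  qed
  \<comment> \<open>The 1 makes the homogeneity factor \<open>l ^ Suc N\<close> at least
    \<open>l\<close>; the other bound then comes from
    \<open>l * \<epsilon> \<le> G z \<le> n * (2 * K)\<close>.\<close>
  define B where "B = max 1 (real n * (2 * K) / \<epsilon>)"
  have "norm (z j) \<le> B" if z: "\<forall>i\<ge>n. z i = 0" "(\<Sum>i<n. of_nat (m i) * z i) = 0"
    "\<forall>i<n. norm (poly (crit_poly n m (z, c)) (z i)) \<le> K" and j: "j < n" for z c j
  proof (rule ccontr)
    assume "\<not> norm (z j) \<le> B"
    define l where "l = Max ((\<lambda>i. norm (z i)) ` {..<n})"
    have lz: "norm (z i) \<le> l" if "i < n" for i unfolding l_def using that by (intro Max_ge) auto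
    then have l: "l > B" using \<open>\<not> norm (z j) \<le> B\<close> j by force
    then have l1: "l > 1" by (simp add: B_def)
    have "l \<in> (\<lambda>i. norm (z i)) ` {..<n}" unfolding l_def using j by (intro Max_in) auto
    then obtain i0 where i0: "i0 < n" "norm (z i0) = l" by auto
    define y where "y i = z i / of_real l" for i
    have zy: "z = (\<lambda>i. of_real l * y i)" using l1 by (auto simp: y_def)
    have "y \<in> S"
    proof -
      have "norm (y i) \<le> (if i < n then 1 else 0)" for i
        using lz[of i] z(1) l1 by (auto simp: y_def norm_divide)
      moreover have "(\<Sum>i<n. of_nat (m i) * y i) = 0"
      proof -
        have "(\<Sum>i<n. of_nat (m i) * y i) = (\<Sum>i<n. of_nat (m i) * z i) / of_real l"
          by (simp add: y_def sum_divide_distrib)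
        then show ?thesis using z(2) by simp
      qed
      moreover have "norm (y i0) = 1" using i0 l1 by (simp add: y_def norm_divide)
      ultimately show ?thesis using i0(1) unfolding S_def by blast
    qed
    then have "\<epsilon> \<le> G y" by (rule \<epsilon>)
    have "G z = l ^ Suc N * G y"
    proof -
      have "poly (pint (nodal n m z)) (z i) = of_real l ^ Suc N * poly (pint (nodal n m y)) (y i)" for i
        unfolding N_def by (subst (1 2) zy) (rule pint_nodal_scale)
      then have "G z = (\<Sum>i<n. norm (of_real l ^ Suc N * (poly (pint (nodal n m y)) (y i) - poly (pint (nodal n m y)) (y 0))))"
        unfolding G_def by (simp only: right_diff_distrib)
      also have "\<dots> = l ^ Suc N * G y"
        unfolding G_def sum_distrib_left norm_mult norm_power using l1 by simp
      finally show ?thesis .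
    qed
    moreover have "l * \<epsilon> \<le> l ^ Suc N * G y"
      using \<open>\<epsilon> \<le> G y\<close> \<epsilon>(1) l1 self_le_power[of l "Suc N"] by (intro mult_mono) auto
    moreover have "G z \<le> real n * (2 * K)"
    proof -
      have "norm (poly (pint (nodal n m z)) (z i) - poly (pint (nodal n m z)) (z 0)) \<le> 2 * K" if "i < n" for i
      proof -
        have "poly (pint (nodal n m z)) (z i) - poly (pint (nodal n m z)) (z 0)
           = poly (crit_poly n m (z, c)) (z i) - poly (crit_poly n m (z, c)) (z 0)"
          by (simp add: crit_poly_def)
        also have "norm \<dots> \<le> norm (poly (crit_poly n m (z, c)) (z i)) + norm (poly (crit_poly n m (z, c)) (z 0))"
          by (rule norm_triangle_ineq4)
        also have "\<dots> \<le> K + K" using z(3) that by (intro add_mono) auto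
        finally show ?thesis by simp
      qed
      then have "G z \<le> (\<Sum>i<n. 2 * K)" unfolding G_def by (intro sum_mono) auto
      then show ?thesis by simp
    qed
    ultimately have "l * \<epsilon> \<le> real n * (2 * K)" by linarith
    then have "l \<le> real n * (2 * K) / \<epsilon>" using \<epsilon>(1) by (simp add: le_divide_eq)
    then show False using l by (simp add: B_def)
  qed
  then show ?thesis by blast
qed

text \<open>The leading coefficient \<open>1 / (N + 1)\<close> is the same for all \<open>u\<close>,
  and the other coefficients are bounded on the compact set, so the leading term dominates
  uniformly.\<close>

lemma sublevel_bounded_uniformly:
  assumes U: "compact U"
  shows "\<exists>B. \<forall>u\<in>U. \<forall>x. norm (poly (crit_poly n m u) x) \<le> K \<longrightarrow> norm x \<le> B"
proof -
  define N where "N = (\<Sum>i<n. m i)"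
  define g where "g u = norm (snd u) + (\<Sum>k<N. norm (coeff (nodal n m (fst u)) k / of_nat (Suc k)))" for u :: "(nat \<Rightarrow> complex) \<times> complex"
  have "continuous_on U (\<lambda>u. coeff (nodal n m (fst u)) k)" for k
    by (rule continuous_on_compose2[OF continuous_on_coeff_nodal[of UNIV] continuous_on_fst[OF continuous_on_id]]) auto
  then have "continuous_on U g" unfolding g_def
    by (intro continuous_intros) (auto simp del: of_nat_Suc)
  then have "bounded (g ` U)" using U compact_continuous_image compact_imp_bounded by blast
  then obtain C where C: "\<And>u. u \<in> U \<Longrightarrow> \<bar>g u\<bar> \<le> C" unfolding bounded_iff by auto
  have "norm x \<le> max 1 (real (Suc N) * (\<bar>K\<bar> + C))"
    if u: "u \<in> U" and K: "norm (poly (crit_poly n m u) x) \<le> K" for u x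
  proof (rule ccontr)
    assume neg: "\<not> ?thesis"
    then have x1: "norm x > 1" by simp
    define a where "a k = coeff (nodal n m (fst u)) k / of_nat (Suc k)" for k
    have "lead_coeff (nodal n m (fst u)) = 1" unfolding nodal_def lead_coeff_prod by (simp add: lead_coeff_power)
    then have aN: "a N = 1 / of_nat (Suc N)" by (simp add: a_def N_def degree_nodal)
    have "poly (crit_poly n m u) x = snd u + (\<Sum>k\<le>N. a k * x ^ Suc k)"
      unfolding poly_crit_poly a_def N_def ..
    also have "\<dots> = snd u + (\<Sum>k<N. a k * x ^ Suc k) + a N * x ^ Suc N"
      by (simp add: lessThan_Suc_atMost[symmetric] del: power_Suc)
    finally have eq: "a N * x ^ Suc N = poly (crit_poly n m u) x - (snd u + (\<Sum>k<N. a k * x ^ Suc k))"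
      by simp
    have xp: "norm x ^ Suc k \<le> norm x ^ N" if "k < N" for k
      using x1 that by (intro power_increasing) auto
    have xN: "1 \<le> norm x ^ N" using x1 by (simp add: one_le_power)
    have "norm (snd u + (\<Sum>k<N. a k * x ^ Suc k)) \<le> norm (snd u) + (\<Sum>k<N. norm (a k * x ^ Suc k))"
      by (rule order_trans[OF norm_triangle_ineq add_left_mono[OF norm_sum]])
    also have "\<dots> \<le> norm (snd u) * norm x ^ N + (\<Sum>k<N. norm (a k) * norm x ^ N)"
    proof (rule add_mono)
      show "norm (snd u) \<le> norm (snd u) * norm x ^ N"
        using xN mult_left_mono[of 1 "norm x ^ N" "norm (snd u)"] by simp
      show "(\<Sum>k<N. norm (a k * x ^ Suc k)) \<le> (\<Sum>k<N. norm (a k) * norm x ^ N)"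
        by (rule sum_mono) (auto simp: norm_mult norm_power simp del: power_Suc intro!: mult_left_mono xp)
    qed
    also have "\<dots> = g u * norm x ^ N"
      by (simp add: g_def a_def distrib_right sum_distrib_right)
    also have "\<dots> \<le> C * norm x ^ N" using C[OF u] xN by (intro mult_right_mono) auto
    finally have 1: "norm (snd u + (\<Sum>k<N. a k * x ^ Suc k)) \<le> C * norm x ^ N" .
    have "norm (poly (crit_poly n m u) x) \<le> \<bar>K\<bar> * norm x ^ N"
      using K xN mult_left_mono[of 1 "norm x ^ N" "\<bar>K\<bar>"] by simp
    then have "norm (a N * x ^ Suc N) \<le> (\<bar>K\<bar> + C) * norm x ^ N"
      unfolding eq using 1 norm_triangle_ineq4[of "poly (crit_poly n m u) x" "snd u + (\<Sum>k<N. a k * x ^ Suc k)"]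
      by (simp add: distrib_right)
    moreover have "norm (a N * x ^ Suc N) = norm x / real (Suc N) * norm x ^ N"
      by (simp add: aN norm_mult norm_divide norm_power del: of_nat_Suc)
    ultimately have "norm x / real (Suc N) * norm x ^ N \<le> (\<bar>K\<bar> + C) * norm x ^ N" by simp
    then have "norm x / real (Suc N) \<le> \<bar>K\<bar> + C" using xN mult_le_cancel_right by (metis not_one_le_zero order.strict_trans1 zero_less_one less_le_not_le linorder_not_less)
    then have "norm x \<le> real (Suc N) * (\<bar>K\<bar> + C)" by (simp add: divide_le_eq mult.commute del: of_nat_Suc)
    then show False using neg by simp
  qed
  then show ?thesis by blast
qed

section \<open>Minimisation\<close>

text \<open>A homeomorphism of the plane that moves the real critical values of the initial polynomial into
  the upper or the lower half-plane according to the parity of their index, by the sign of \<open>f\<close>.\<close>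

definition bend :: "real poly \<Rightarrow> complex \<Rightarrow> complex" where
  "bend f w = w + \<i> * of_real (poly f (Re w))"

definition unbend :: "real poly \<Rightarrow> complex \<Rightarrow> complex" where
  "unbend f w = w - \<i> * of_real (poly f (Re w))"

text \<open>Even indices get -1, because among \<open>0, ..., n - 1\<close> they are the ones that
  number n/2 rounded up.\<close>

definition par :: "nat \<Rightarrow> real" where
  "par i = (if even i then -1 else 1)"

text \<open>The distance of a sheared value from the centre of the disc for the parity of
  \<open>i\<close>. Both discs have radius \<open>M\<close> and touch the real axis at 0, so they
  stay apart for every \<open>M\<close> and exhaust the two open half-planes as \<open>M\<close>
  grows.\<close>

definition level :: "nat \<Rightarrow> (nat \<Rightarrow> nat) \<Rightarrow> real poly \<Rightarrow> real \<Rightarrow> nat \<Rightarrow> (nat \<Rightarrow> complex) \<times> complex \<Rightarrow> complex \<Rightarrow> real" where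
  "level n m f M i u x = norm (bend f (poly (crit_poly n m u) x) - of_real (par i * M) * \<i>)"

lemma par_cases: "par i = 1 \<or> par i = -1"
  by (simp add: par_def)

lemma bend_unbend [simp]: "bend f (unbend f w) = w" "unbend f (bend f w) = w"
  by (simp_all add: bend_def unbend_def)

lemma continuous_on_bend: "continuous_on S (bend f)"
  unfolding bend_def by (intro continuous_intros)

lemma continuous_on_unbend: "continuous_on S (unbend f)"
  unfolding unbend_def by (intro continuous_intros)

text \<open>The powers of \<open>b\<close> with respect to the two circles are
  \<open>|b|^2 - 2 t M Im b\<close> with opposite signs \<open>t\<close>; their sum
  \<open>2 |b|^2\<close> would be negative.\<close>

lemma opposite_discs_disjoint:
  assumes "norm (b - of_real (par i * M) * \<i>) \<le> M" "norm (b - of_real (par k * M) * \<i>) < M" "par i \<noteq> par k"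
  shows False
proof -
  have sq: "norm (b - of_real (t * M) * \<i>) ^ 2 = Re b ^ 2 + Im b ^ 2 - 2 * t * M * Im b + M ^ 2"
    if "t = 1 \<or> t = -1" for t
    unfolding cmod_power2 using that by (auto simp: power2_eq_square algebra_simps)
  have "M > 0" using assms(2) norm_ge_zero le_less_trans by blast
  have "norm (b - of_real (par i * M) * \<i>) ^ 2 \<le> M ^ 2"
    using assms(1) by (intro power_mono) auto
  moreover have "norm (b - of_real (par k * M) * \<i>) ^ 2 < M ^ 2"
    using assms(2) by (intro power_strict_mono) auto
  moreover have "par k = - par i" using assms(3) par_cases[of i] par_cases[of k] by auto
  ultimately have "Re b ^ 2 + Im b ^ 2 - 2 * par i * M * Im b \<le> 0" "Re b ^ 2 + Im b ^ 2 + 2 * par i * M * Im b < 0"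
    using sq[OF par_cases[of i]] sq[OF par_cases[of k]] by auto
  from add_le_less_mono[OF this] have "(Re b)\<^sup>2 + (Im b)\<^sup>2 < 0" by simp
  then show False using sum_power2_ge_zero[of "Re b" "Im b"] by linarith
qed

lemma continuous_on_level: "continuous_on UNIV (\<lambda>(u, x). level n m f M i u x)"
proof -
  have "continuous_on UNIV (\<lambda>ux :: ((nat \<Rightarrow> complex) \<times> complex) \<times> complex. bend f ((\<lambda>(u, x). poly (crit_poly n m u) x) ux))"
    by (rule continuous_on_compose2[OF continuous_on_bend[of UNIV] continuous_on_crit_poly subset_UNIV])
  then show ?thesis unfolding level_def case_prod_beta by (intro continuous_intros)
qed

lemma continuous_on_level_crit: "continuous_on S (\<lambda>u. level n m f M i u (fst u i))"
proof -
  have "continuous_on S (\<lambda>u. bend f (poly (crit_poly n m u) (fst u i)))"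
    by (rule continuous_on_compose2[OF continuous_on_bend[of UNIV] continuous_on_crit_value subset_UNIV])
  then show ?thesis unfolding level_def by (intro continuous_intros)
qed

lemma level_le_imp_value_bounded:
  "\<exists>K. \<forall>i u x. level n m f M i u x \<le> M \<longrightarrow> norm (poly (crit_poly n m u) x) \<le> K"
proof -
  define D where "D = unbend f ` (cball (\<i> * of_real M) M \<union> cball (- \<i> * of_real M) M)"
  have "compact D" unfolding D_def
    by (intro compact_continuous_image continuous_on_unbend compact_Un compact_cball)
  then have "bounded D" by (rule compact_imp_bounded)
  then obtain K where K: "\<forall>w\<in>D. norm w \<le> K" unfolding bounded_iff ..
  have "norm (poly (crit_poly n m u) x) \<le> K" if "level n m f M i u x \<le> M" for i u x
  proof (rule bspec[OF K])
    let ?w = "poly (crit_poly n m u) x"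
    have "bend f ?w \<in> cball (\<i> * of_real M) M \<union> cball (- \<i> * of_real M) M"
      using that par_cases[of i] by (auto simp: level_def dist_norm norm_minus_commute mult.commute)
    then have "unbend f (bend f ?w) \<in> D" unfolding D_def by (rule imageI)
    then show "?w \<in> D" by simp
  qed
  then show ?thesis by blast
qed

lemma bounded_level_set:
  assumes "compact U"
  shows "bounded {x. \<exists>u\<in>U. level n m f M i u x \<le> M}"
proof -
  obtain K where K: "\<And>u x. level n m f M i u x \<le> M \<Longrightarrow> norm (poly (crit_poly n m u) x) \<le> K"
    using level_le_imp_value_bounded by blast
  obtain B where "\<And>u x. u \<in> U \<Longrightarrow> norm (poly (crit_poly n m u) x) \<le> K \<Longrightarrow> norm x \<le> B"
    using sublevel_bounded_uniformly[OF assms] by blast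
  then show ?thesis unfolding bounded_iff using K by blast
qed

text \<open>Critical points with values of the same sign are to stay in different components. This keeps them
  from colliding in the limit.\<close>

definition separated :: "nat \<Rightarrow> (nat \<Rightarrow> nat) \<Rightarrow> real poly \<Rightarrow> real \<Rightarrow> (nat \<Rightarrow> complex) \<times> complex \<Rightarrow> bool" where
  "separated n m f M u \<longleftrightarrow> (\<forall>i<n. \<forall>k<n. i \<noteq> k \<longrightarrow> par i = par k \<longrightarrow>
     \<not> connected_component {x. level n m f M i u x < M} (fst u i) (fst u k))"

text \<open>The first two clauses remove irrelevant coordinates and translations, which makes the
  set compact. The bound \<open>\<mu>\<close>, later below \<open>M\<close>, is non-strict so that
  the set is closed and yet keeps critical values off the boundary circles.\<close>

definition admissible :: "nat \<Rightarrow> (nat \<Rightarrow> nat) \<Rightarrow> real poly \<Rightarrow> real \<Rightarrow> real \<Rightarrow> ((nat \<Rightarrow> complex) \<times> complex) set" where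
  "admissible n m f M \<mu> = {u. (\<forall>i\<ge>n. fst u i = 0) \<and> (\<Sum>i<n. of_nat (m i) * fst u i) = 0 \<and>
     (\<forall>i<n. level n m f M i u (fst u i) \<le> \<mu>) \<and> separated n m f M u}"

lemma tendsto_coord:
  fixes us :: "nat \<Rightarrow> (nat \<Rightarrow> complex) \<times> complex"
  assumes "us \<longlonglongrightarrow> u"
  shows "(\<lambda>j. fst (us j) i) \<longlonglongrightarrow> fst u i"
proof -
  show ?thesis by (rule continuous_on_tendsto_compose[OF continuous_on_fst_coord[of UNIV] assms]) auto
qed

text \<open>Being joined inside an open sublevel set survives small perturbations, so not being
  joined passes to limits.\<close>

lemma closed_separated: "closed {u. separated n m f M u}"
  unfolding closed_sequential_limits
proof (intro allI impI, elim conjE)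
  fix us u assume us: "\<forall>j. us j \<in> {u. separated n m f M u}" and lim: "us \<longlonglongrightarrow> u"
  show "u \<in> {u. separated n m f M u}"
    unfolding mem_Collect_eq separated_def
  proof (intro allI impI notI)
    fix i k assume ik: "i < n" "k < n" "i \<noteq> k" "par i = par k"
      and cc: "connected_component {x. level n m f M i u x < M} (fst u i) (fst u k)"
    have "eventually (\<lambda>j. connected_component {x. level n m f M i (us j) x < M} (fst (us j) i) (fst (us j) k)) sequentially"
      by (rule connected_component_sublevel_persists[OF continuous_on_level lim tendsto_coord[OF lim] tendsto_coord[OF lim] cc])
    then obtain j where "connected_component {x. level n m f M i (us j) x < M} (fst (us j) i) (fst (us j) k)"
      using eventually_happens trivial_limit_sequentially by blast
    moreover have "separated n m f M (us j)" using us by simp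
    ultimately show False using ik unfolding separated_def by blast
  qed
qed

text \<open>Bounded levels bound the critical values, and properness then bounds the critical
  points. The constant term is the difference between the critical value at \<open>z 0\<close> and
  the antiderivative there.\<close>

lemma compact_admissible:
  assumes m: "\<And>i. i < n \<Longrightarrow> m i > 0" and n: "n > 0" and \<mu>: "\<mu> \<le> M"
  shows "compact (admissible n m f M \<mu>)"
proof -
  obtain K where K: "\<And>i u x. level n m f M i u x \<le> M \<Longrightarrow> norm (poly (crit_poly n m u) x) \<le> K"
    using level_le_imp_value_bounded by metis
  obtain B where B: "\<forall>z c. (\<forall>i\<ge>n. z i = 0) \<longrightarrow> (\<Sum>i<n. of_nat (m i) * z i) = 0 \<longrightarrow>
     (\<forall>i<n. norm (poly (crit_poly n m (z, c)) (z i)) \<le> K) \<longrightarrow> (\<forall>i<n. norm (z i) \<le> B)"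
    using crit_values_proper[OF m, where K = K] ..
  define Z where "Z = {z :: nat \<Rightarrow> complex. \<forall>i. norm (z i) \<le> (if i < n then B else 0)}"
  have cZ: "compact Z" unfolding Z_def by (rule compact_polydisc)
  have "bounded ((\<lambda>z. poly (pint (nodal n m z)) (z 0)) ` Z)"
    using compact_continuous_image[OF continuous_on_pint_nodal cZ] compact_imp_bounded by blast
  then obtain C where C: "\<And>z. z \<in> Z \<Longrightarrow> norm (poly (pint (nodal n m z)) (z 0)) \<le> C"
    unfolding bounded_iff by auto
  have sub: "admissible n m f M \<mu> \<subseteq> Z \<times> cball 0 (K + C)"
  proof
    fix u assume u: "u \<in> admissible n m f M \<mu>"
    obtain z c where zc: "u = (z, c)" by (cases u)
    have val: "norm (poly (crit_poly n m (z, c)) (z i)) \<le> K" if "i < n" for i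
    proof (rule K)
      show "level n m f M i (z, c) (z i) \<le> M"
        using u that \<mu> unfolding admissible_def zc by fastforce
    qed
    have "norm (z j) \<le> B" if "j < n" for j
      using B[rule_format, of z c j] val that u unfolding admissible_def zc by simp
    then have "z \<in> Z" using u unfolding admissible_def zc Z_def by simp
    moreover have "norm c \<le> K + C"
    proof -
      have "c = poly (crit_poly n m (z, c)) (z 0) - poly (pint (nodal n m z)) (z 0)"
        by (simp add: crit_poly_def)
      then have "norm c \<le> norm (poly (crit_poly n m (z, c)) (z 0)) + norm (poly (pint (nodal n m z)) (z 0))"
        using norm_triangle_ineq4 by metis
      then show ?thesis using val[OF n] C[OF \<open>z \<in> Z\<close>] by linarith
    qed
    ultimately show "u \<in> Z \<times> cball 0 (K + C)" by (simp add: zc)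
  qed
  have "admissible n m f M \<mu> = (\<Inter>i\<in>{n..}. {u. fst u i = 0}) \<inter> {u. (\<Sum>i<n. of_nat (m i) * fst u i) = 0} \<inter>
      (\<Inter>i\<in>{..<n}. {u. level n m f M i u (fst u i) \<le> \<mu>}) \<inter> {u. separated n m f M u}"
    unfolding admissible_def by auto
  moreover have "closed \<dots>"
    by (intro closed_Int closed_INT ballI closed_separated closed_Collect_eq closed_Collect_le
        continuous_on_level_crit continuous_on_sum continuous_on_mult continuous_on_const continuous_on_fst_coord)
  ultimately have "closed (admissible n m f M \<mu>)" by simp
  then have "compact ((Z \<times> cball 0 (K + C)) \<inter> admissible n m f M \<mu>)"
    by (intro compact_Int_closed compact_Times cZ compact_cball)
  then show ?thesis using sub by (simp add: Int_absorb1)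
qed

text \<open>Coinciding points of equal parity would trivially share a component; those of opposite
  parity would put one value into two disjoint discs.\<close>

lemma admissible_inj:
  assumes u: "u \<in> admissible n m f M \<mu>" and \<mu>: "\<mu> < M"
  shows "inj_on (fst u) {..<n}"
proof (rule inj_onI)
  fix i k assume ik: "i \<in> {..<n}" "k \<in> {..<n}" "fst u i = fst u k"
  have lt: "level n m f M l u (fst u l) < M" if "l < n" for l
    using u \<mu> that unfolding admissible_def by fastforce
  show "i = k"
  proof (rule ccontr)
    assume "i \<noteq> k"
    show False
    proof (cases "par i = par k")
      case True
      have "connected_component {x. level n m f M i u x < M} (fst u i) (fst u k)"
        unfolding ik(3)[symmetric] by (rule connected_component_refl) (use lt[of i] ik in simp)
      then show False using u True \<open>i \<noteq> k\<close> ik unfolding admissible_def separated_def by blast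
    next
      case False
      have "norm (bend f (poly (crit_poly n m u) (fst u i)) - of_real (par i * M) * \<i>) \<le> M"
        "norm (bend f (poly (crit_poly n m u) (fst u i)) - of_real (par k * M) * \<i>) < M"
        using lt[of i] lt[of k] ik unfolding level_def by simp_all
      then show False using opposite_discs_disjoint False by blast
    qed
  qed
qed

text \<open>No critical value lies on the circle of radius \<open>M\<close>: values of the same
  parity are strictly inside, the others in the opposite disc. Passing to the closed sublevel set
  thus joins no components, which is what makes separation an open condition.\<close>

lemma admissible_closed_component:
  assumes m: "\<And>i. i < n \<Longrightarrow> m i > 0" and u: "u \<in> admissible n m f M \<mu>" and \<mu>: "0 < \<mu>" "\<mu> < M"
    and ik: "i < n" "k < n" "i \<noteq> k" "par i = par k"
  shows "\<not> connected_component {x. level n m f M i u x \<le> M} (fst u i) (fst u k)"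
proof
  assume cc: "connected_component {x. level n m f M i u x \<le> M} (fst u i) (fst u k)"
  have lt: "level n m f M l u (fst u l) < M" if "l < n" for l
    using u \<mu> that unfolding admissible_def by fastforce
  let ?T = "\<lambda>x. poly (crit_poly n m u) x"
  have hol: "?T holomorphic_on UNIV" by (rule poly_holomorphic)
  have "connected_component {x. norm (bend f (?T x) - of_real (par i * M) * \<i>) < M} (fst u i) (fst u k)"
  proof (rule connected_component_sublevel_closed[OF hol continuous_on_bend[of _ f] continuous_on_unbend[of _ f]])
    show "M > 0" using \<mu> by simp
    show "connected_component {x. norm (bend f (?T x) - of_real (par i * M) * \<i>) \<le> M} (fst u i) (fst u k)"
      using cc by (simp add: level_def)
    show "norm (bend f (?T (fst u i)) - of_real (par i * M) * \<i>) < M"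
      using lt[OF ik(1)] by (simp add: level_def)
    show "norm (bend f (?T (fst u k)) - of_real (par i * M) * \<i>) < M"
      using lt[OF ik(2)] ik(4) by (simp add: level_def)
    fix p assume p: "norm (bend f (?T p) - of_real (par i * M) * \<i>) = M"
    have "deriv ?T p = poly (nodal n m (fst u)) p"
      using DERIV_imp_deriv[OF poly_DERIV[of "crit_poly n m u" p]] by simp
    moreover have "poly (nodal n m (fst u)) p \<noteq> 0"
    proof
      assume "poly (nodal n m (fst u)) p = 0"
      then obtain l where l: "l < n" "p = fst u l" by (auto simp: poly_nodal_eq_0_iff)
      then have ll: "norm (bend f (?T p) - of_real (par l * M) * \<i>) < M" using lt by (simp add: level_def)
      show False
      proof (cases "par i = par l")
        case True then show False using p ll by simp
      next
        case False then show False using opposite_discs_disjoint[OF _ ll False] p by simp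
      qed
    qed
    ultimately show "deriv ?T p \<noteq> 0" by simp
  qed simp_all
  then have "connected_component {x. level n m f M i u x < M} (fst u i) (fst u k)" by (simp add: level_def)
  then show False using u ik unfolding admissible_def separated_def by blast
qed

text \<open>The velocity \<open>e\<close> is the preimage of \<open>- h\<close> under the
  differential of \<open>bend f\<close> at \<open>w 0\<close>, so the sheared value moves straight
  towards its centre.\<close>

lemma bend_value_deriv:
  fixes w :: "real \<Rightarrow> complex"
  assumes w: "(w has_vector_derivative e) (at 0)"
    and h: "h = bend f (w 0) - of_real a * \<i>"
    and e: "e = Complex (- Re h) (- Im h + poly (pderiv f) (Re (w 0)) * Re h)"
  shows "((\<lambda>t. (norm (bend f (w t) - of_real a * \<i>))\<^sup>2) has_real_derivative (- 2 * (norm h)\<^sup>2)) (at 0)"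
proof -
  have dRe: "((\<lambda>t. Re (w t)) has_real_derivative Re e) (at 0)"
    and dIm: "((\<lambda>t. Im (w t)) has_real_derivative Im e) (at 0)"
    unfolding has_real_derivative_iff_has_vector_derivative
    by (rule bounded_linear.has_vector_derivative[OF bounded_linear_Re w],
        rule bounded_linear.has_vector_derivative[OF bounded_linear_Im w])
  have df: "((\<lambda>t. poly f (Re (w t))) has_real_derivative poly (pderiv f) (Re (w 0)) * Re e) (at 0)"
    by (rule DERIV_chain2[OF poly_DERIV dRe])
  have "((\<lambda>t. (Re (w t))\<^sup>2 + (Im (w t) + poly f (Re (w t)) - a)\<^sup>2) has_real_derivative
      (2 * Re (w 0) * Re e + 2 * (Im (w 0) + poly f (Re (w 0)) - a) * (Im e + poly (pderiv f) (Re (w 0)) * Re e))) (at 0)"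
    by (rule derivative_eq_intros dRe dIm df refl | simp)+
  moreover have "(\<lambda>t. (Re (w t))\<^sup>2 + (Im (w t) + poly f (Re (w t)) - a)\<^sup>2) = (\<lambda>t. (norm (bend f (w t) - of_real a * \<i>))\<^sup>2)"
    by (rule ext) (simp add: cmod_power2 bend_def)
  moreover have "2 * Re (w 0) * Re e + 2 * (Im (w 0) + poly f (Re (w 0)) - a) * (Im e + poly (pderiv f) (Re (w 0)) * Re e)
     = - 2 * (norm h)\<^sup>2"
    unfolding e cmod_power2 h bend_def by (simp add: power2_eq_square algebra_simps)
  ultimately show ?thesis by simp
qed

text \<open>At a minimiser of the sum of squares \<open>E\<close>, all critical values can be moved
  towards their centres at once. If \<open>E\<close> were positive it would decrease, while for
  short times the level bounds and the separation persist.\<close>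

lemma level_minimiser_zero:
  assumes m: "\<And>i. i < n \<Longrightarrow> m i > 0" and n: "n > 0" and \<mu>: "0 < \<mu>" "\<mu> < M"
    and ne: "admissible n m f M \<mu> \<noteq> {}"
  shows "\<exists>u\<in>admissible n m f M \<mu>. \<forall>i<n. level n m f M i u (fst u i) = 0"
proof -
  define E where "E u = (\<Sum>i<n. (level n m f M i u (fst u i))\<^sup>2)" for u
  have "continuous_on (admissible n m f M \<mu>) E"
    unfolding E_def by (intro continuous_intros continuous_on_level_crit)
  then obtain u where u: "u \<in> admissible n m f M \<mu>" and min: "\<And>y. y \<in> admissible n m f M \<mu> \<Longrightarrow> E u \<le> E y"
    using continuous_attains_inf[OF compact_admissible[OF m n less_imp_le[OF \<mu>(2)]] ne] by blast
  have "E u = 0"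
  proof (rule ccontr)
    assume "E u \<noteq> 0"
    moreover have "E u \<ge> 0" unfolding E_def by (intro sum_nonneg) auto
    ultimately have Epos: "E u > 0" by simp
    obtain z c where zc: "u = (z, c)" by (cases u)
    define w0 where "w0 i = poly (crit_poly n m u) (z i)" for i
    define h where "h i = bend f (w0 i) - of_real (par i * M) * \<i>" for i
    define e where "e i = Complex (- Re (h i)) (- Im (h i) + poly (pderiv f) (Re (w0 i)) * Re (h i))" for i
    have "inj_on z {..<n}" using admissible_inj[OF u \<mu>(2)] by (simp add: zc)
    then obtain d0 c' where d0: "(\<Sum>k<n. of_nat (m k) * d0 k) = 0"
      "\<And>i. i < n \<Longrightarrow> c' + (\<Sum>k<n. d0 k * poly (pint (nodal_deriv n m z k)) (z i)) = e i"
      using crit_value_direction[where z = z and n = n and m = m and e = e] m n by blast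
    \<comment> \<open>The cut-off keeps the coordinates from \<open>n\<close> on at 0, as
      admissibility demands.\<close>
    define d where "d i = (if i < n then d0 i else 0)" for i
    have d: "(\<Sum>k<n. of_nat (m k) * d k) = 0"
      "\<And>i. i < n \<Longrightarrow> c' + (\<Sum>k<n. d k * poly (pint (nodal_deriv n m z k)) (z i)) = e i"
      using d0 by (simp_all add: d_def)
    define us where "us t = (\<lambda>l. z l + of_real t * d l, c + of_real t * c')" for t :: real
    have us0: "us 0 = u" by (simp add: us_def zc)
    have cus: "continuous_on UNIV us"
      unfolding us_def
      by (intro continuous_on_Pair continuous_on_coordinatewise_then_product continuous_on_add continuous_on_mult
          continuous_on_const continuous_on_of_real continuous_on_id)
    define w where "w i t = poly (crit_poly n m (us t)) (fst (us t) i)" for i t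
    have dw: "(w i has_vector_derivative e i) (at 0)" if "i < n" for i
    proof -
      have "((\<lambda>s. poly (crit_poly n m (\<lambda>l. z l + s * d l, c + s * c')) (z i + s * d i)) has_field_derivative e i) (at (of_real 0))"
        using crit_value_deriv[where z = z and n = n and m = m and d = d and c = c and e = c' and i = i] that m d(2) by simp
      then have "((\<lambda>s. poly (crit_poly n m (\<lambda>l. z l + s * d l, c + s * c')) (z i + s * d i)) \<circ> of_real has_vector_derivative e i) (at 0)"
        using has_vector_derivative_real_field by (force simp: o_def)
      then show ?thesis by (simp add: w_def[abs_def] us_def o_def)
    qed
    define q where "q i t = (level n m f M i (us t) (fst (us t) i))\<^sup>2" for i t
    have dq: "(q i has_real_derivative - 2 * q i 0) (at 0)" if i: "i < n" for i
    proof -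
      have w0: "w i 0 = w0 i" by (simp add: w_def w0_def us0 zc)
      have "((\<lambda>t. (norm (bend f (w i t) - of_real (par i * M) * \<i>))\<^sup>2) has_real_derivative (- 2 * (norm (h i))\<^sup>2)) (at 0)"
        by (rule bend_value_deriv[OF dw[OF i]]) (simp_all add: h_def w0 e_def)
      moreover have "q i = (\<lambda>t. (norm (bend f (w i t) - of_real (par i * M) * \<i>))\<^sup>2)"
        by (rule ext) (simp add: q_def level_def w_def)
      moreover have "q i 0 = (norm (h i))\<^sup>2" by (simp add: q_def level_def h_def w0_def us0 zc)
      ultimately show ?thesis by simp
    qed
    have "((\<lambda>t. \<Sum>i<n. q i t) has_real_derivative (\<Sum>i<n. - 2 * q i 0)) (at 0)"
      by (intro DERIV_sum dq) simp
    moreover have "(\<lambda>t. \<Sum>i<n. q i t) = (\<lambda>t. E (us t))" by (rule ext) (simp add: E_def q_def)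
    moreover have "(\<Sum>i<n. - 2 * q i 0) = - 2 * E u" by (simp add: E_def q_def us0 sum_distrib_left)
    ultimately have dE: "((\<lambda>t. E (us t)) has_real_derivative - 2 * E u) (at 0)" by simp
    have dec: "eventually (\<lambda>t. g t < g 0) (at_right 0)" if "(g has_real_derivative l) (at 0)" "l < 0" for g :: "real \<Rightarrow> real" and l
      using DERIV_neg_dec_right[OF that] by (auto simp: eventually_at_right_field)
    have evE: "eventually (\<lambda>t. E (us t) < E u) (at_right 0)"
      using dec[OF dE] Epos us0 by simp
    \<comment> \<open>Each level has to respect \<open>\<mu>\<close> separately. A nonzero one
      decreases; one already at 0 has derivative 0 and is controlled by continuity and
      \<open>\<mu> > 0\<close>.\<close>
    have evq: "eventually (\<lambda>t. \<forall>i\<in>{..<n}. q i t \<le> \<mu>\<^sup>2) (at_right 0)"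
    proof (rule eventually_ball_finite, simp, intro ballI)
      fix i assume i: "i \<in> {..<n}"
      have q0: "q i 0 \<le> \<mu>\<^sup>2"
        using u i unfolding q_def us0 admissible_def by (auto simp: level_def intro!: power_mono)
      show "eventually (\<lambda>t. q i t \<le> \<mu>\<^sup>2) (at_right 0)"
      proof (cases "q i 0 = 0")
        case True
        have "isCont (q i) 0" using dq i DERIV_isCont by blast
        then have "(q i \<longlongrightarrow> 0) (at_right 0)" using True by (simp add: isCont_def filterlim_at_split)
        then have "eventually (\<lambda>t. q i t < \<mu>\<^sup>2) (at_right 0)" using \<mu>(1) by (intro order_tendstoD(2)) auto
        then show ?thesis by eventually_elim simp
      next
        case False
        then have "q i 0 > 0" by (simp add: q_def)
        then have "eventually (\<lambda>t. q i t < q i 0) (at_right 0)" using dec[OF dq] i by simp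
        then show ?thesis by eventually_elim (use q0 in simp)
      qed
    qed
    \<comment> \<open>Otherwise the two points are joined at times tending to 0, hence joined in the
      closed sublevel set of \<open>u\<close>, which admissibility with \<open>\<mu> < M\<close>
      excludes.\<close>
    have evpair: "eventually (\<lambda>t. \<not> connected_component {x. level n m f M i (us t) x < M} (fst (us t) i) (fst (us t) k)) (at_right 0)"
      if ik: "i < n" "k < n" "i \<noteq> k" "par i = par k" for i k
    proof (rule ccontr)
      define X where "X t \<longleftrightarrow> connected_component {x. level n m f M i (us t) x < M} (fst (us t) i) (fst (us t) k)" for t
      assume "\<not> ?thesis"
      then have "\<exists>t. 0 < t \<and> t < b \<and> X t" if "b > 0" for b
        using that unfolding eventually_at_right_field X_def by blast
      then have "\<exists>t. 0 < t \<and> t < inverse (real (Suc j)) \<and> X t" for j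
        by (simp del: of_nat_Suc)
      then obtain t where t: "\<And>j. 0 < t j" "\<And>j. t j < inverse (real (Suc j))" "\<And>j. X (t j)" by metis
      have lim0: "t \<longlonglongrightarrow> 0"
        by (rule tendsto_sandwich[OF _ _ tendsto_const LIMSEQ_inverse_real_of_nat])
           (use t in \<open>auto intro!: always_eventually less_imp_le simp del: of_nat_Suc\<close>)
      have lim: "(\<lambda>j. us (t j)) \<longlonglongrightarrow> u"
        using continuous_on_tendsto_compose[OF cus lim0] by (simp add: us0)
      have "compact (us ` {0..1})"
        using cus continuous_on_subset by (intro compact_continuous_image) auto
      then have "bounded {x. \<exists>v\<in>us ` {0..1}. level n m f M i v x \<le> M}" by (rule bounded_level_set)
      moreover have "t j \<in> {0..1}" for j
      proof -
        have "inverse (real (Suc j)) \<le> 1" by (simp add: inverse_le_1_iff)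
        then show ?thesis using t(1,2)[of j] by simp
      qed
      then have "{x. \<exists>j. level n m f M i (us (t j)) x \<le> M} \<subseteq> {x. \<exists>v\<in>us ` {0..1}. level n m f M i v x \<le> M}" by blast
      ultimately have b1: "bounded {x. \<exists>j. level n m f M i (us (t j)) x \<le> M}" using bounded_subset by blast
      have b2: "bounded {x. level n m f M i u x \<le> M}" using bounded_level_set[of "{u}"] by simp
      have "connected_component {x. level n m f M i u x \<le> M} (fst u i) (fst u k)"
        by (rule connected_component_sublevel_limit[OF continuous_on_level b1 b2 lim tendsto_coord[OF lim] tendsto_coord[OF lim]])
           (use t(3) in \<open>simp add: X_def\<close>)
      then show False using admissible_closed_component[OF m u \<mu> ik] by blast
    qed
    have "eventually (\<lambda>t. \<forall>i\<in>{..<n}. \<forall>k\<in>{..<n}. i \<noteq> k \<longrightarrow> par i = par k \<longrightarrow>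
       \<not> connected_component {x. level n m f M i (us t) x < M} (fst (us t) i) (fst (us t) k)) (at_right 0)"
    proof (intro eventually_ball_finite ballI finite_lessThan)
      fix i k assume "i \<in> {..<n}" "k \<in> {..<n}"
      then show "eventually (\<lambda>t. i \<noteq> k \<longrightarrow> par i = par k \<longrightarrow>
          \<not> connected_component {x. level n m f M i (us t) x < M} (fst (us t) i) (fst (us t) k)) (at_right 0)"
        using evpair[of i k] by (cases "i \<noteq> k \<and> par i = par k") auto
    qed
    then have "eventually (\<lambda>t. separated n m f M (us t)) (at_right 0)"
      by eventually_elim (auto simp: separated_def)
    then have "eventually (\<lambda>t. E (us t) < E u \<and> us t \<in> admissible n m f M \<mu>) (at_right 0)"
      using evE evq
    proof eventually_elim
      case (elim t)
      have "fst (us t) i = 0" if "i \<ge> n" for i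
        using u that by (simp add: us_def d_def admissible_def zc)
      moreover have "(\<Sum>i<n. of_nat (m i) * fst (us t) i) = 0"
      proof -
        have "(\<Sum>i<n. of_nat (m i) * fst (us t) i) = (\<Sum>i<n. of_nat (m i) * z i) + of_real t * (\<Sum>i<n. of_nat (m i) * d i)"
          by (simp add: us_def sum.distrib sum_distrib_left algebra_simps)
        then show ?thesis using u d(1) by (simp add: admissible_def zc)
      qed
      moreover have "level n m f M i (us t) (fst (us t) i) \<le> \<mu>" if "i < n" for i
      proof (rule power2_le_imp_le)
        show "(level n m f M i (us t) (fst (us t) i))\<^sup>2 \<le> \<mu>\<^sup>2" using elim(3) that by (simp add: q_def)
      qed (use \<mu> in simp)
      ultimately show ?case using elim(1,2) by (simp add: admissible_def)
    qed
    then obtain t where "E (us t) < E u" "us t \<in> admissible n m f M \<mu>"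
      using eventually_happens'[OF trivial_limit_at_right_real] by blast
    then show False using min by fastforce
  qed
  then have "\<forall>i<n. level n m f M i u (fst u i) = 0"
    unfolding E_def by (simp add: sum_nonneg_eq_0_iff)
  then show ?thesis using u by blast
qed

section \<open>The initial configuration\<close>

definition real_coeffs :: "complex poly \<Rightarrow> bool" where
  "real_coeffs p \<longleftrightarrow> (\<forall>k. coeff p k \<in> \<real>)"

lemma real_coeffs_mult: "real_coeffs p \<Longrightarrow> real_coeffs q \<Longrightarrow> real_coeffs (p * q)"
  unfolding real_coeffs_def coeff_mult by (intro allI sum_in_Reals Reals_mult) auto

lemma real_coeffs_prod: "(\<And>i. i \<in> S \<Longrightarrow> real_coeffs (f i)) \<Longrightarrow> real_coeffs (\<Prod>i\<in>S. f i)"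
proof (induction S rule: infinite_finite_induct)
  case (insert a S)
  then show ?case by (auto intro: real_coeffs_mult)
qed (auto simp: real_coeffs_def)

lemma real_coeffs_power: "real_coeffs p \<Longrightarrow> real_coeffs (p ^ e)"
proof (induction e)
  case 0
  show ?case by (auto simp: real_coeffs_def)
next
  case (Suc e)
  then show ?case by (simp add: real_coeffs_mult)
qed

lemma real_coeffs_linear: "a \<in> \<real> \<Longrightarrow> real_coeffs [:- a, 1:]"
  by (auto simp: real_coeffs_def coeff_pCons split: nat.split)

lemma real_coeffs_pint: "real_coeffs p \<Longrightarrow> real_coeffs (pint p)"
  by (auto simp: real_coeffs_def coeff_pint simp del: of_nat_Suc intro!: Reals_divide)

lemma real_coeffs_poly: "real_coeffs p \<Longrightarrow> x \<in> \<real> \<Longrightarrow> poly p x \<in> \<real>"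
  unfolding real_coeffs_def poly_altdef by (intro sum_in_Reals Reals_mult Reals_power) auto

lemma real_coeffs_nodal: "(\<And>i. i < n \<Longrightarrow> z i \<in> \<real>) \<Longrightarrow> real_coeffs (nodal n m z)"
  unfolding nodal_def by (intro real_coeffs_prod real_coeffs_power real_coeffs_linear) auto

lemma real_coeffs_nodal_deriv:
  assumes "\<And>i. i < n \<Longrightarrow> z i \<in> \<real>" "k < n"
  shows "real_coeffs (nodal_deriv n m z k)"
proof -
  have eq: "nodal_deriv n m z k = [:- of_nat (m k):] * ([:- z k, 1:] ^ (m k - 1) * (\<Prod>i\<in>{..<n} - {k}. [:- z i, 1:] ^ m i))"
    by (simp add: nodal_deriv_def)
  have "real_coeffs [:- of_nat (m k):]"
    by (auto simp: real_coeffs_def coeff_pCons split: nat.split)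
  then show ?thesis
    unfolding eq
    by (intro real_coeffs_mult real_coeffs_prod real_coeffs_power real_coeffs_linear) (use assms in auto)
qed

lemma real_crit_poly:
  assumes "\<And>i. i < n \<Longrightarrow> z i \<in> \<real>" "c \<in> \<real>" "x \<in> \<real>"
  shows "poly (crit_poly n m (z, c)) x \<in> \<real>"
  using assms real_coeffs_poly[OF real_coeffs_pint[OF real_coeffs_nodal]]
  by (auto simp: crit_poly_def intro!: Reals_add)

text \<open>Equally spaced points are shifted to centroid 0 and then perturbed so that the i-th
  critical value moves with speed \<open>i\<close>. Coinciding values separate at once, and the
  order of the points survives for short times. Distinct values are needed to prescribe signs of the
  shear polynomial at them.\<close>

lemma real_configuration_exists:
  assumes m: "\<And>i. i < n \<Longrightarrow> m i > 0" and n: "n > 0"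
  shows "\<exists>(x :: nat \<Rightarrow> real) c :: real. (\<forall>i k. i < k \<longrightarrow> k < n \<longrightarrow> x i < x k) \<and> (\<forall>i\<ge>n. x i = 0) \<and>
     (\<Sum>i<n. of_nat (m i) * x i) = 0 \<and>
     inj_on (\<lambda>i. Re (poly (crit_poly n m (\<lambda>i. of_real (x i), of_real c)) (of_real (x i)))) {..<n}"
proof -
  define N where "N = (\<Sum>i<n. real (m i))"
  have N: "N > 0" unfolding N_def using m n by (intro sum_pos) auto
  define b where "b = (\<Sum>i<n. real (m i) * real i) / N"
  define x0 where "x0 i = (if i < n then real i - b else 0)" for i
  have x0sum: "(\<Sum>i<n. real (m i) * x0 i) = 0"
  proof -
    have "(\<Sum>i<n. real (m i) * x0 i) = (\<Sum>i<n. real (m i) * real i) - N * b"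
      by (simp add: x0_def right_diff_distrib sum_subtractf sum_distrib_right N_def)
    then show ?thesis using N by (simp add: b_def)
  qed
  define z where "z i = complex_of_real (x0 i)" for i
  have "inj_on z {..<n}" by (auto simp: inj_on_def z_def x0_def)
  then obtain d c' where d: "(\<Sum>k<n. of_nat (m k) * d k) = 0"
    "\<And>i. i < n \<Longrightarrow> c' + (\<Sum>k<n. d k * poly (pint (nodal_deriv n m z k)) (z i)) = of_nat i"
    using crit_value_direction[where z = z and n = n and m = m and e = of_nat] m n by blast
  \<comment> \<open>The linear system for the speeds has real coefficients and a real right-hand
    side, so real parts of a solution solve it too.\<close>
  define dr where "dr i = (if i < n then Re (d i) else 0)" for i
  have dr1: "(\<Sum>k<n. real (m k) * dr k) = 0"
    using arg_cong[OF d(1), of Re] by (simp add: dr_def)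
  have dr2: "of_real (Re c') + (\<Sum>k<n. of_real (dr k) * poly (pint (nodal_deriv n m z k)) (z i)) = (of_nat i :: complex)"
    if i: "i < n" for i
  proof -
    define a where "a k = Re (poly (pint (nodal_deriv n m z k)) (z i))" for k
    have a: "poly (pint (nodal_deriv n m z k)) (z i) = of_real (a k)" if "k < n" for k
    proof -
      have "poly (pint (nodal_deriv n m z k)) (z i) \<in> \<real>"
        using that by (intro real_coeffs_poly real_coeffs_pint real_coeffs_nodal_deriv) (auto simp: z_def)
      then show ?thesis unfolding a_def by simp
    qed
    have "c' + (\<Sum>k<n. d k * of_real (a k)) = of_nat i" using d(2)[OF i] a by simp
    then have "Re (c' + (\<Sum>k<n. d k * of_real (a k))) = Re (of_nat i)" by (rule arg_cong)
    then have "Re c' + (\<Sum>k<n. Re (d k) * a k) = real i" by simp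
    then have "complex_of_real (Re c' + (\<Sum>k<n. dr k * a k)) = of_nat i"
      by (simp add: dr_def del: of_real_add of_real_sum)
    then show ?thesis using a by simp
  qed
  define x where "x s i = x0 i + s * dr i" for s :: real and i
  define c where "c s = s * Re c'" for s :: real
  define V where "V i s = poly (crit_poly n m (\<lambda>l. of_real (x s l), of_real (c s))) (of_real (x s i))" for i s
  define v where "v i s = Re (V i s)" for i s
  have dv: "(v i has_real_derivative real i) (at 0)" if i: "i < n" for i
  proof -
    have "((\<lambda>s. poly (crit_poly n m (\<lambda>l. z l + s * of_real (dr l), 0 + s * of_real (Re c'))) (z i + s * of_real (dr i))) has_field_derivative of_nat i) (at (of_real 0))"
      using crit_value_deriv[where z = z and n = n and m = m and d = "\<lambda>l. of_real (dr l)" and c = 0 and e = "of_real (Re c')" and i = i] i m dr2[OF i] by simp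
    then have "((\<lambda>s. poly (crit_poly n m (\<lambda>l. z l + s * of_real (dr l), 0 + s * of_real (Re c'))) (z i + s * of_real (dr i))) \<circ> of_real has_vector_derivative of_nat i) (at 0)"
      using has_vector_derivative_real_field by (force simp: o_def)
    then have "(V i has_vector_derivative of_nat i) (at 0)"
      by (simp add: V_def[abs_def] x_def c_def z_def o_def)
    then show ?thesis
      unfolding v_def[abs_def] has_real_derivative_iff_has_vector_derivative
      using bounded_linear.has_vector_derivative[OF bounded_linear_Re, of "V i"] by fastforce
  qed
  have evx: "eventually (\<lambda>s. x s i < x s k) (at_right 0)" if "i < k" "k < n" for i k
  proof -
    have "((\<lambda>s. x s k - x s i) \<longlongrightarrow> (x0 k + 0 * dr k) - (x0 i + 0 * dr i)) (at_right 0)"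
      unfolding x_def by (intro tendsto_intros)
    moreover have "(x0 k + 0 * dr k) - (x0 i + 0 * dr i) > 0" using that by (simp add: x0_def)
    ultimately have "eventually (\<lambda>s. x s k - x s i > 0) (at_right 0)" by (rule order_tendstoD(1))
    then show ?thesis by eventually_elim simp
  qed
  have evv: "eventually (\<lambda>s. v i s \<noteq> v k s) (at_right 0)" if "i < n" "k < n" "i < k" for i k
  proof -
    have dg: "((\<lambda>s. v k s - v i s) has_real_derivative real k - real i) (at 0)"
      using that by (intro DERIV_diff dv)
    show ?thesis
    proof (cases "v k 0 - v i 0 = 0")
      case True
      have "real k - real i > 0" using that by simp
      then obtain \<delta> where "\<delta> > 0" "\<And>h. h > 0 \<Longrightarrow> h < \<delta> \<Longrightarrow> v k 0 - v i 0 < v k (0 + h) - v i (0 + h)"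
        using DERIV_pos_inc_right[OF dg] by blast
      then show ?thesis using True unfolding eventually_at_right_field by (intro exI[of _ \<delta>]) force
    next
      case False
      have "isCont (\<lambda>s. v k s - v i s) 0" using dg DERIV_isCont by blast
      then have "((\<lambda>s. v k s - v i s) \<longlongrightarrow> v k 0 - v i 0) (at_right 0)"
        by (simp add: isCont_def filterlim_at_split)
      then have "eventually (\<lambda>s. v k s - v i s \<noteq> 0) (at_right 0)"
        using False by (rule tendsto_imp_eventually_ne)
      then show ?thesis by eventually_elim simp
    qed
  qed
  have "eventually (\<lambda>s. \<forall>i\<in>{..<n}. \<forall>k\<in>{..<n}. i < k \<longrightarrow> x s i < x s k \<and> v i s \<noteq> v k s) (at_right 0)"
  proof (intro eventually_ball_finite ballI finite_lessThan)
    fix i k assume ik: "i \<in> {..<n}" "k \<in> {..<n}"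
    show "eventually (\<lambda>s. i < k \<longrightarrow> x s i < x s k \<and> v i s \<noteq> v k s) (at_right 0)"
    proof (cases "i < k")
      case True
      then show ?thesis using evx[of i k] evv[of i k] ik by (simp add: eventually_conj_iff)
    qed simp
  qed
  then obtain s where s: "\<forall>i\<in>{..<n}. \<forall>k\<in>{..<n}. i < k \<longrightarrow> x s i < x s k \<and> v i s \<noteq> v k s"
    using eventually_happens'[OF trivial_limit_at_right_real] by blast
  have "inj_on (\<lambda>i. v i s) {..<n}"
  proof (rule inj_onI)
    fix i k assume "i \<in> {..<n}" "k \<in> {..<n}" "v i s = v k s"
    then show "i = k" using s by (metis linorder_neqE_nat)
  qed
  moreover have "(\<Sum>i<n. of_nat (m i) * x s i) = 0"
  proof -
    have "(\<Sum>i<n. of_nat (m i) * x s i) = (\<Sum>i<n. real (m i) * x0 i) + s * (\<Sum>i<n. real (m i) * dr i)"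
      by (simp add: x_def sum.distrib sum_distrib_left algebra_simps)
    then show ?thesis using x0sum dr1 by simp
  qed
  moreover have "\<forall>i\<ge>n. x s i = 0" by (simp add: x_def x0_def dr_def)
  ultimately show ?thesis
    using s unfolding v_def V_def by (intro exI[of _ "x s"] exI[of _ "c s"]) auto
qed

lemma disc_im_sign:
  assumes "norm (b - of_real (t * M) * \<i>) < M" "t = 1 \<or> t = -1"
  shows "t * Im b > 0"
proof -
  have "\<bar>Im (b - of_real (t * M) * \<i>)\<bar> < M" using assms(1) abs_Im_le_cmod le_less_trans by blast
  then show ?thesis using assms(2) by auto
qed

text \<open>Between two real critical points of the same parity lies one of the other parity, whose barrier
  avoids the preimage of their disc.\<close>

lemma admissible_nonempty:
  assumes m: "\<And>i. i < n \<Longrightarrow> m i > 0" and n: "n > 0"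
  shows "\<exists>f M \<mu>. 0 < \<mu> \<and> \<mu> < M \<and> admissible n m f M \<mu> \<noteq> {}"
proof -
  obtain x :: "nat \<Rightarrow> real" and c :: real where x: "\<And>i k. i < k \<Longrightarrow> k < n \<Longrightarrow> x i < x k" "\<And>i. i \<ge> n \<Longrightarrow> x i = 0"
     "(\<Sum>i<n. of_nat (m i) * x i) = 0" and
     inj: "inj_on (\<lambda>i. Re (poly (crit_poly n m (\<lambda>i. of_real (x i), of_real c)) (of_real (x i)))) {..<n}"
    using real_configuration_exists[where m = m and n = n, OF m n] by blast
  define u where "u = (\<lambda>i. complex_of_real (x i), complex_of_real c)"
  define v where "v i = Re (poly (crit_poly n m u) (of_real (x i)))" for i
  have realT: "poly (crit_poly n m u) (of_real y) \<in> \<real>" for y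
    unfolding u_def by (rule real_crit_poly) auto
  have vT: "poly (crit_poly n m u) (of_real (x i)) = of_real (v i)" for i
    using realT[of "x i"] by (simp add: v_def)
  have vne: "v i \<noteq> v k" if "i < n" "k < n" "i \<noteq> k" for i k
    using inj that unfolding v_def u_def inj_on_def by auto
  \<comment> \<open>Squares make \<open>P b\<close> nonnegative on the line; it vanishes exactly at
    the critical values of one parity, so the difference \<open>f\<close> has the sign
    \<open>par i\<close> at \<open>v i\<close>.\<close>
  define P where "P b = (\<Prod>k\<in>{k. k < n \<and> even k = b}. [:- v k, 1:] ^ 2)" for b :: bool
  have P0: "poly (P (even i)) (v i) = 0" if "i < n" for i
    using that by (auto simp: P_def poly_prod)
  have Ppos: "poly (P (\<not> even i)) (v i) > 0" if "i < n" for i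
    unfolding P_def poly_prod
  proof (rule prod_pos)
    fix k assume "k \<in> {k. k < n \<and> even k = (\<not> even i)}"
    then have "v i \<noteq> v k" using vne[of i k] that by auto
    then show "poly ([:- v k, 1:] ^ 2) (v i) > 0" by simp
  qed
  define f where "f = P True - P False"
  have fsign: "par i * poly f (v i) > 0" if "i < n" for i
    using P0[OF that] Ppos[OF that] by (cases "even i") (auto simp: f_def par_def)
  \<comment> \<open>The threshold radius: expanding the square of the level shows that it is below
    \<open>M\<close> exactly when \<open>q i < M\<close>.\<close>
  define q where "q i = ((v i)\<^sup>2 + (poly f (v i))\<^sup>2) / (2 * (par i * poly f (v i)))" for i
  have q0: "q i \<ge> 0" if "i < n" for i using fsign[OF that] by (simp add: q_def)
  define M where "M = 1 + (\<Sum>i<n. q i)"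
  have qM: "q i < M" if "i < n" for i
    using member_le_sum[of i "{..<n}" q] q0 that by (simp add: M_def)
  have "(\<Sum>i<n. q i) \<ge> 0" by (rule sum_nonneg) (use q0 in auto)
  then have M: "M > 0" by (simp add: M_def)
  have lev: "level n m f M i u (of_real (x i)) < M" if i: "i < n" for i
  proof (rule power2_less_imp_less)
    have "(level n m f M i u (of_real (x i)))\<^sup>2 = (v i)\<^sup>2 + (poly f (v i) - par i * M)\<^sup>2"
      by (simp add: level_def vT bend_def cmod_power2)
    also have "\<dots> = ((v i)\<^sup>2 + (poly f (v i))\<^sup>2) - 2 * (par i * poly f (v i)) * M + M\<^sup>2"
      using par_cases[of i] by (auto simp: power2_eq_square algebra_simps)
    also have "(v i)\<^sup>2 + (poly f (v i))\<^sup>2 = q i * (2 * (par i * poly f (v i)))"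
      using fsign[OF i] par_cases[of i] by (auto simp: q_def)
    also have "q i * (2 * (par i * poly f (v i))) < M * (2 * (par i * poly f (v i)))"
      using qM[OF i] fsign[OF i] by (intro mult_strict_right_mono) auto
    finally show "(level n m f M i u (of_real (x i)))\<^sup>2 < M\<^sup>2" by (simp add: algebra_simps)
  qed (use M in simp)
  \<comment> \<open>The entry \<open>M / 2\<close> makes \<open>\<mu>\<close> positive even if all
    levels happen to be 0.\<close>
  define \<mu> where "\<mu> = Max (insert (M / 2) ((\<lambda>i. level n m f M i u (of_real (x i))) ` {..<n}))"
  have \<mu>0: "0 < \<mu>"
  proof -
    have "M / 2 \<le> \<mu>" unfolding \<mu>_def by (rule Max_ge) auto
    then show ?thesis using M by simp
  qed
  have \<mu>M: "\<mu> < M" unfolding \<mu>_def using M lev by (subst Max_less_iff) auto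
  have \<mu>lev: "level n m f M i u (of_real (x i)) \<le> \<mu>" if "i < n" for i
    unfolding \<mu>_def using that by (intro Max_ge) auto
  have sep: "\<not> connected_component {y. level n m f M i u y < M} (of_real (x i)) (of_real (x k))"
    if ik: "i < k" "k < n" "par i = par k" for i k
  proof
    assume cc: "connected_component {y. level n m f M i u y < M} (of_real (x i)) (of_real (x k))"
    \<comment> \<open>The neighbour has opposite parity and hence lies strictly before
      \<open>k\<close>.\<close>
    define l where "l = Suc i"
    have pl: "par l = - par i" by (simp add: l_def par_def)
    have "l \<noteq> k" using pl ik(3) par_cases[of i] by auto
    then have l: "i < l" "l < k" "l < n" using ik by (auto simp: l_def)
    define A where "A = {a. norm (bend f a - of_real (par i * M) * \<i>) < M}"
    have fl: "par i * poly f (v l) < 0" using fsign[OF l(3)] pl by simp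
    have "isCont (\<lambda>y. par i * poly f y) (v l)" by (intro continuous_intros)
    then have "((\<lambda>y. par i * poly f y) \<longlongrightarrow> par i * poly f (v l)) (at (v l))" by (simp add: isCont_def)
    then have "eventually (\<lambda>y. par i * poly f y < 0) (at (v l))" using fl by (rule order_tendstoD(2))
    then obtain \<epsilon> where \<epsilon>: "\<epsilon> > 0" "\<And>y. y \<noteq> v l \<Longrightarrow> dist y (v l) < \<epsilon> \<Longrightarrow> par i * poly f y < 0"
      unfolding eventually_at by blast
    \<comment> \<open>Over this interval the shear pushes away from the disc of \<open>i\<close>, so
      a value whose sheared image is in that disc must lie strictly on the side \<open>par i\<close>
      of the real axis. The barrier through \<open>x l\<close> uses the other side.\<close>
    have neg: "par i * poly f y < 0" if "\<bar>y - v l\<bar> < \<epsilon>" for y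
      using \<epsilon>(2)[of y] fl that by (cases "y = v l") (auto simp: dist_real_def)
    have "\<not> path_component {y. poly (crit_poly n m u) y \<in> A} (of_real (x i)) (of_real (x k))"
    proof (rule real_critical_points_separated[OF realT _ _ par_cases[of i] \<epsilon>(1) x(1)[OF l(1,3)] x(1)[OF l(2) ik(2)]])
      show "degree (crit_poly n m u) > 0" by (simp add: degree_crit_poly)
      show "poly (pderiv (crit_poly n m u)) (of_real (x l)) = 0"
        using l m by (auto simp: u_def poly_nodal_eq_0_iff)
      fix a assume a: "a \<in> A" "\<bar>Re a - Re (poly (crit_poly n m u) (of_real (x l)))\<bar> < \<epsilon>"
      then have "par i * poly f (Re a) < 0" using neg[of "Re a"] by (simp add: v_def)
      moreover have "par i * Im (bend f a) > 0"
        using a(1) disc_im_sign par_cases unfolding A_def by blast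
      moreover have "Im (bend f a) = Im a + poly f (Re a)" by (simp add: bend_def)
      ultimately show "par i * Im a > 0" by (simp add: distrib_left)
    qed
    moreover have "{y. poly (crit_poly n m u) y \<in> A} = {y. level n m f M i u y < M}"
      by (simp add: A_def level_def)
    moreover have "open {y. level n m f M i u y < M}"
    proof -
      have "continuous_on UNIV (\<lambda>y. (\<lambda>(u, x). level n m f M i u x) (u, y))"
        by (rule continuous_on_compose2[OF continuous_on_level _ subset_UNIV])
           (rule continuous_on_Pair[OF continuous_on_const continuous_on_id])
      then have "continuous_on UNIV (\<lambda>y. level n m f M i u y)" by simp
      then show ?thesis by (intro open_Collect_less continuous_on_const)
    qed
    ultimately show False using cc by (simp add: open_path_connected_component)
  qed
  have "separated n m f M u"
    unfolding separated_def
  proof (intro allI impI)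
    fix i k assume ik: "i < n" "k < n" "i \<noteq> k" "par i = par k"
    have "level n m f M i = level n m f M k" using ik(4) by (intro ext) (simp add: level_def)
    then show "\<not> connected_component {y. level n m f M i u y < M} (fst u i) (fst u k)"
      using sep[of i k] sep[of k i] ik connected_component_sym
      by (cases "i < k") (fastforce simp: u_def)+
  qed
  moreover have "(\<Sum>i<n. of_nat (m i) * fst u i) = 0"
    using arg_cong[OF x(3), of complex_of_real] by (simp add: u_def)
  ultimately have "u \<in> admissible n m f M \<mu>"
    using x(2) \<mu>lev by (simp add: admissible_def u_def)
  then show ?thesis using \<mu>0 \<mu>M by blast
qed

section \<open>Counting critical points\<close>

lemma linear_power_dvd_higher_pderiv:
  assumes "[:- a, 1:] ^ j dvd pderiv p" "i < j"
  shows "[:- a, 1:] ^ (j - i) dvd (pderiv ^^ Suc i) (p :: complex poly)"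
  using assms(2)
proof (induction i)
  case 0
  then show ?case using assms(1) by simp
next
  case (Suc i)
  then have "[:- a, 1:] ^ Suc (j - Suc i) dvd (pderiv ^^ Suc i) p" by (simp add: Suc_diff_Suc del: funpow.simps power_Suc)
  then have "[:- a, 1:] ^ (j - Suc i) dvd pderiv ((pderiv ^^ Suc i) p)" by (rule power_dvd_pderiv)
  then show ?case by simp
qed

lemma crit_point_multI:
  assumes "[:- a, 1:] ^ j dvd pderiv p"
  shows "crit_point_mult p j a"
  unfolding crit_point_mult_def
proof
  fix i assume i: "i \<in> {1..j}"
  then obtain l where l: "i = Suc l" "l < j" by (cases i) auto
  have "[:- a, 1:] dvd [:- a, 1:] ^ (j - l)" using l by (intro dvd_power) auto
  also have "\<dots> dvd (pderiv ^^ i) p" unfolding l(1) using assms l(2) by (rule linear_power_dvd_higher_pderiv)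
  finally show "poly ((pderiv ^^ i) p) a = 0" unfolding poly_eq_0_iff_dvd .
qed

text \<open>Differentiation lowers the order of a root by exactly one. This turns vanishing
  derivatives back into multiplicity, for the upper bound on the number of critical points.\<close>

lemma higher_pderiv_zero_imp_order:
  fixes p :: "complex poly"
  assumes "p \<noteq> 0" "\<And>i. i < j \<Longrightarrow> poly ((pderiv ^^ i) p) a = 0"
  shows "j \<le> order a p"
  using assms
proof (induction j arbitrary: p)
  case (Suc j)
  have root: "poly p a = 0" using Suc.prems(2)[of 0] by simp
  have "pderiv p \<noteq> 0"
  proof
    assume "pderiv p = 0"
    then obtain c where "p = [:c:]" using pderiv_eq_0_iff degree_eq_zeroE by blast
    then show False using root Suc.prems(1) by simp
  qed
  moreover have "poly ((pderiv ^^ i) (pderiv p)) a = 0" if "i < j" for i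
    using Suc.prems(2)[of "Suc i"] that by (simp add: funpow_swap1)
  ultimately have "j \<le> order a (pderiv p)" by (rule Suc.IH)
  then show ?case using order_pderiv[OF Suc.prems(1) root] by simp
qed simp

lemma card_even_below: "card {i. i < n \<and> even i} = (n + 1) div 2" "card {i. i < n \<and> odd i} = n div 2"
proof -
  have "card {i. i < n \<and> even i} = (n + 1) div 2 \<and> card {i. i < n \<and> odd i} = n div 2"
  proof (induction n)
    case (Suc n)
    have "{i. i < Suc n \<and> even i} = (if even n then insert n {i. i < n \<and> even i} else {i. i < n \<and> even i})"
      "{i. i < Suc n \<and> odd i} = (if odd n then insert n {i. i < n \<and> odd i} else {i. i < n \<and> odd i})"
      by (auto simp: less_Suc_eq)
    then show ?case using Suc by (auto elim!: evenE oddE)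
  qed simp
  then show "card {i. i < n \<and> even i} = (n + 1) div 2" "card {i. i < n \<and> odd i} = n div 2" by auto
qed

theorem mainTheorem2:
  fixes d j :: nat
  assumes "1 \<le> j" and "j < d"
  shows "\<exists>T :: complex poly. degree T = d \<and>
     card {z. crit_point_mult T j z \<and> poly T z = -1} = nat \<lceil>real ((d - 1) div j) / 2\<rceil> \<and>
     card {z. crit_point_mult T j z \<and> poly T z = 1} = nat \<lfloor>real ((d - 1) div j) / 2\<rfloor>"
proof -
  define n where "n = (d - 1) div j"
  \<comment> \<open>The surplus goes to index 0, which exists as \<open>n > 0\<close>; the exponents
    then add up to \<open>d - 1\<close>, the degree of the derivative.\<close>
  define m where "m i = (if i = 0 then j + (d - 1) mod j else j)" for i :: nat
  have n: "n > 0" using assms by (simp add: n_def div_greater_zero_iff)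
  have m: "m i > 0" for i using assms by (simp add: m_def)
  have mj: "j \<le> m i" for i by (simp add: m_def)
  have summ: "(\<Sum>i<n. m i) = d - 1"
  proof -
    have "(\<Sum>i<n. m i) = m 0 + (\<Sum>i\<in>{..<n} - {0}. m i)"
      using n by (subst sum.remove[of _ 0]) auto
    also have "(\<Sum>i\<in>{..<n} - {0}. m i) = (\<Sum>i\<in>{..<n} - {0}. j)"
      by (rule sum.cong) (auto simp: m_def)
    also have "\<dots> = (n - 1) * j" using n by simp
    also have "m 0 + (n - 1) * j = n * j + (d - 1) mod j"
      using n by (cases n) (simp_all add: m_def)
    also have "\<dots> = d - 1" by (simp add: n_def)
    finally show ?thesis .
  qed
  obtain f M \<mu> where f: "0 < \<mu>" "\<mu> < M" "admissible n m f M \<mu> \<noteq> {}"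
    using admissible_nonempty[where m = m and n = n, OF m n] by blast
  obtain u where u: "u \<in> admissible n m f M \<mu>" "\<And>i. i < n \<Longrightarrow> level n m f M i u (fst u i) = 0"
    using level_minimiser_zero[where m = m and n = n, OF m n f] by blast
  define z where "z = fst u"
  have inj: "inj_on z {..<n}" unfolding z_def by (rule admissible_inj[OF u(1) f(2)])
  have M: "M \<noteq> 0" using f by simp
  \<comment> \<open>Both centres have real part 0, so unshearing subtracts the same number
    \<open>\<i> * f 0\<close> from them. Adding it back and dividing by \<open>M * \<i>\<close>
    leaves the values \<open>par i\<close>.\<close>
  define T where "T = smult (1 / (of_real M * \<i>)) (crit_poly n m u + [:\<i> * of_real (poly f 0):])"
  have val: "poly T (z i) = of_real (par i)" if "i < n" for i
  proof -
    have "bend f (poly (crit_poly n m u) (z i)) = of_real (par i * M) * \<i>"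
      using u(2)[OF that] by (simp add: level_def z_def)
    from arg_cong[OF this, of "unbend f"]
    have "poly (crit_poly n m u) (z i) = unbend f (of_real (par i * M) * \<i>)" by simp
    then have "poly (crit_poly n m u) (z i) = of_real (par i * M) * \<i> - \<i> * of_real (poly f 0)"
      by (simp add: unbend_def)
    then show ?thesis using M by (simp add: T_def)
  qed
  have "degree (crit_poly n m u + [:\<i> * of_real (poly f 0):]) = degree (crit_poly n m u)"
    by (rule degree_add_eq_left) (simp add: degree_crit_poly)
  then have degT: "degree T = d" using M assms by (simp add: T_def degree_crit_poly summ)
  have dT: "pderiv T = smult (1 / (of_real M * \<i>)) (nodal n m z)"
    by (simp add: T_def pderiv_smult pderiv_add pderiv_pCons z_def)
  have dT0: "pderiv T \<noteq> 0" using M by (simp add: dT)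
  define S where "S v = {x. crit_point_mult T j x \<and> poly T x = v}" for v
  have crit: "crit_point_mult T j (z i)" if "i < n" for i
  proof (rule crit_point_multI)
    have "[:- z i, 1:] ^ j dvd [:- z i, 1:] ^ m i" by (rule le_imp_power_dvd[OF mj])
    also have "\<dots> dvd nodal n m z" unfolding nodal_def using that by (intro dvd_prodI) auto
    finally show "[:- z i, 1:] ^ j dvd pderiv T" unfolding dT by (rule dvd_smult)
  qed
  have ord: "j \<le> order x (pderiv T)" if "x \<in> S v" for x v
  proof (rule higher_pderiv_zero_imp_order[OF dT0])
    fix i assume "i < j"
    then have "Suc i \<in> {1..j}" by simp
    then have "poly ((pderiv ^^ Suc i) T) x = 0"
      using that unfolding S_def crit_point_mult_def by blast
    then show "poly ((pderiv ^^ i) (pderiv T)) x = 0" by (simp add: funpow_swap1)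
  qed
  have root: "poly (pderiv T) x = 0" if "x \<in> S v" for x v
  proof -
    have "order x (pderiv T) \<noteq> 0" using ord[OF that] assms by simp
    then show ?thesis using order_root by blast
  qed
  have finS: "finite (S v)" for v
    using poly_roots_finite[OF dT0] root by (auto intro: finite_subset[rotated])
  \<comment> \<open>\<open>crit_point_mult\<close> bounds the multiplicity only from below, so
    points beyond the constructed ones have to be excluded. Every point of either set takes at least
    \<open>j\<close> of the \<open>d - 1\<close> zeros of the derivative; this allows
    \<open>n\<close> in total, which the two lower bounds already reach.\<close>
  have "j * card (S (-1) \<union> S 1) = (\<Sum>x\<in>S (-1) \<union> S 1. j)" by simp
  also have "\<dots> \<le> (\<Sum>x\<in>S (-1) \<union> S 1. order x (pderiv T))"
    by (rule sum_mono) (auto intro: ord)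
  also have "\<dots> \<le> (\<Sum>x | poly (pderiv T) x = 0. order x (pderiv T))"
    using poly_roots_finite[OF dT0] root by (intro sum_mono2) auto
  also have "\<dots> \<le> d - 1"
    using sum_order_le_degree[OF dT0] degree_pderiv[of T] degT by simp
  finally have "card (S (-1) \<union> S 1) \<le> n"
    unfolding n_def using assms by (simp add: less_eq_div_iff_mult_less_eq mult.commute)
  moreover have "S (-1) \<inter> S 1 = {}" by (auto simp: S_def)
  ultimately have upper: "card (S (-1)) + card (S 1) \<le> n"
    using finS by (simp add: card_Un_disjoint)
  have "(n + 1) div 2 \<le> card (S (-1))"
  proof -
    have "(n + 1) div 2 = card (z ` {i. i < n \<and> even i})"
      using inj by (subst card_image) (auto simp: card_even_below intro: inj_on_subset)
    also have "\<dots> \<le> card (S (-1))"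
      using finS crit val by (intro card_mono) (auto simp: S_def par_def)
    finally show ?thesis .
  qed
  moreover have "n div 2 \<le> card (S 1)"
  proof -
    have "n div 2 = card (z ` {i. i < n \<and> odd i})"
      using inj by (subst card_image) (auto simp: card_even_below intro: inj_on_subset)
    also have "\<dots> \<le> card (S 1)"
      using finS crit val by (intro card_mono) (auto simp: S_def par_def)
    finally show ?thesis .
  qed
  ultimately have cards: "card (S (-1)) = (n + 1) div 2" "card (S 1) = n div 2"
    using upper by linarith+
  have "nat \<lceil>real n / 2\<rceil> = (n + 1) div 2" "nat \<lfloor>real n / 2\<rfloor> = n div 2"
    by linarith+
  then show ?thesis using degT cards unfolding S_def n_def by (intro exI[of _ T]) simp
qed

end
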